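(* Let $G$ be a finite (not necessarily abelian) group, and let $V$ be a faithful representation of $G$ of finite dimension $N\geq 1$ over a field $\mathbf{k}$ (of arbitrary characteristic, possibly dividing $|G|$). Then $$\gamma_{\mathrm{field}}(G,V) \geq \sqrt[N]{|G|}.$$
   Context: $\mathbf{k}[V]$ is the ring of polynomial functions on $V$, $\mathbf{k}(V)$ its fraction field, with $G$ acting by $(gf)(v)=f(g^{-1}v)$; $\mathbf{k}[V]^G$, $\mathbf{k}(V)^G$ are the invariants, and $\mathbf{k}[V]^G_{\leq d}$ is the space of invariant polynomials of degree at most $d$. $\gamma_{\mathrm{field}}(G,V)$ is the least natural number $d$ such that $\mathbf{k}(V)^G$ is a finite field extension of its subfield $\mathbf{k}(\mathbf{k}[V]^G_{\leq d})$ (equivalently, such that $\mathbf{k}[V]^G_{\leq d}$ contains a transcendence basis of $\mathbf{k}(V)$ over $\mathbf{k}$). *)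

theory Defs
  imports
    "HOL-Library.Poly_Mapping"
    "HOL-Computational_Algebra.Fraction_Field"
    "HOL-Algebra.Group_Action"
    "HOL-Algebra.Embedded_Algebras"
    "HOL-Algebra.Generated_Fields"
    "HOL-Algebra.Algebraic_Closure_Type"
    Complex_Main
begin

section \<open>Representations\<close>

text \<open>
  The action is by elements of the group of bijections of the whole type \<^typ>\<open>'v\<close>; together with
  linearity this says that \<open>\<rho>\<close> is a homomorphism from \<open>G\<close> to \<open>GL(V)\<close>.
\<close>

locale linear_representation = vector_space scale + group_action G UNIV \<rho>
  for G :: "('g, 'm) monoid_scheme" (structure)
    and scale :: "'k::field \<Rightarrow> 'v::ab_group_add \<Rightarrow> 'v"
    and \<rho> :: "'g \<Rightarrow> 'v \<Rightarrow> 'v" +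
  assumes linear_action: "g \<in> carrier G \<Longrightarrow> Vector_Spaces.linear scale scale (\<rho> g)"

text \<open>
  A basis indexed by a finite type. The type class \<^class>\<open>linorder\<close> on index types is needed only
  because the library's proof that a polynomial ring is an integral domain uses an order on the
  monomials; the order is not referred to otherwise.
\<close>

definition indexed_basis :: "('k::field \<Rightarrow> 'v::ab_group_add \<Rightarrow> 'v) \<Rightarrow> ('n::finite \<Rightarrow> 'v) \<Rightarrow> bool" where
  "indexed_basis scale e \<longleftrightarrow>
     inj e \<and> \<not> module.dependent scale (Set.range e) \<and> module.span scale (Set.range e) = UNIV"

definition coordinate ::
    "('k::field \<Rightarrow> 'v::ab_group_add \<Rightarrow> 'v) \<Rightarrow> ('n::finite \<Rightarrow> 'v) \<Rightarrow> 'n \<Rightarrow> 'v \<Rightarrow> 'k" where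
  "coordinate scale e i v = module.representation scale (Set.range e) v (e i)"


section \<open>The coordinate ring and its fraction field\<close>

text \<open>
  As usual, \<open>k[V]\<close> is the symmetric algebra of the dual space, i.e.\ the ring of formal
  polynomials in the coordinate functions \<open>x\<^sub>i\<close> of a basis (over a finite field this is not the ring
  of the induced functions, which is not a domain). A monomial is its exponent vector.
\<close>

type_synonym ('n, 'k) mpoly = "('n \<Rightarrow>\<^sub>0 nat) \<Rightarrow>\<^sub>0 'k"

definition mconst :: "'k::zero \<Rightarrow> ('n, 'k) mpoly" where
  "mconst c = Poly_Mapping.single 0 c"

definition mvar :: "'n \<Rightarrow> ('n, 'k::zero_neq_one) mpoly" where
  "mvar i = Poly_Mapping.single (Poly_Mapping.single i 1) 1"

definition monom_degree :: "('n::finite \<Rightarrow>\<^sub>0 nat) \<Rightarrow> nat" where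
  "monom_degree m = (\<Sum>i\<in>UNIV. Poly_Mapping.lookup m i)"

text \<open>The total degree, with the convention that the zero polynomial has degree 0.\<close>

definition total_degree :: "('n::finite, 'k::zero) mpoly \<Rightarrow> nat" where
  "total_degree p = Max (insert 0 (monom_degree ` Poly_Mapping.keys p))"

text \<open>
  The evaluation at \<open>a\<close> of a polynomial with coefficients mapped by \<open>h\<close>: for \<^term>\<open>h = id\<close> the value
  at a point, for \<^term>\<open>h = mconst\<close> the substitution of polynomials for the variables.
\<close>

definition meval ::
    "('k::zero \<Rightarrow> 'a::comm_ring_1) \<Rightarrow> ('n::finite \<Rightarrow> 'a) \<Rightarrow> ('n, 'k) mpoly \<Rightarrow> 'a" where
  "meval h a p = (\<Sum>m\<in>Poly_Mapping.keys p.
     h (Poly_Mapping.lookup p m) * (\<Prod>i\<in>UNIV. a i ^ Poly_Mapping.lookup m i))"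

lemma meval_superset:
  assumes "finite S" "Poly_Mapping.keys p \<subseteq> S" "h 0 = 0"
  shows "meval h a p = (\<Sum>m\<in>S. h (Poly_Mapping.lookup p m) * (\<Prod>i\<in>UNIV. a i ^ Poly_Mapping.lookup m i))"
  unfolding meval_def
  by (rule sum.mono_neutral_left) (use assms in \<open>auto simp: in_keys_iff\<close>)

lemma meval_single:
  assumes "h 0 = 0"
  shows "meval h a (Poly_Mapping.single m c) = h c * (\<Prod>i\<in>UNIV. a i ^ Poly_Mapping.lookup m i)"
  using assms by (subst meval_superset[of "{m}"]) auto

lemma mpoly_decompose:
  fixes p :: "('b::type \<Rightarrow>\<^sub>0 'c::comm_monoid_add)"
  shows "p = (\<Sum>m\<in>Poly_Mapping.keys p. Poly_Mapping.single m (Poly_Mapping.lookup p m))"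
  by (rule poly_mapping_eqI)
    (simp add: lookup_sum lookup_single when_def in_keys_iff sum.delta' cong: if_cong)

locale coefficient_hom =
  fixes h :: "'k::comm_ring_1 \<Rightarrow> 'a::comm_ring_1"
  assumes hom_add: "h (x + y) = h x + h y"
    and hom_mult: "h (x * y) = h x * h y"
    and hom_one: "h 1 = 1"
begin

lemma hom_zero: "h 0 = 0"
  using hom_add[of 0 0] by simp

lemma meval_zero: "meval h a 0 = 0"
  by (simp add: meval_def)

lemma meval_add: "meval h a (p + q) = meval h a p + meval h a q"
proof -
  let ?S = "Poly_Mapping.keys p \<union> Poly_Mapping.keys q"
  have "Poly_Mapping.keys (p + q) \<subseteq> ?S"
    by (rule Poly_Mapping.keys_add)
  then show ?thesis
    by (simp add: meval_superset[of ?S] hom_zero lookup_add hom_add distrib_right sum.distrib)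
qed

lemma meval_sum: "meval h a (sum f S) = (\<Sum>x\<in>S. meval h a (f x))"
  by (induction S rule: infinite_finite_induct) (auto simp: meval_zero meval_add)

lemma meval_mult: "meval h a (p * q) = meval h a p * meval h a q"
proof -
  have mono: "meval h a (Poly_Mapping.single m c * Poly_Mapping.single n d) =
      meval h a (Poly_Mapping.single m c) * meval h a (Poly_Mapping.single n d)" for m n c d
    by (simp add: mult_single meval_single hom_zero hom_mult lookup_add power_add prod.distrib)
  have "meval h a (p * q) = meval h a
     ((\<Sum>m\<in>Poly_Mapping.keys p. Poly_Mapping.single m (Poly_Mapping.lookup p m)) *
      (\<Sum>m\<in>Poly_Mapping.keys q. Poly_Mapping.single m (Poly_Mapping.lookup q m)))"
    by (simp only: mpoly_decompose[symmetric])
  also have "\<dots> = meval h a (\<Sum>m\<in>Poly_Mapping.keys p. Poly_Mapping.single m (Poly_Mapping.lookup p m)) *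
      meval h a (\<Sum>m\<in>Poly_Mapping.keys q. Poly_Mapping.single m (Poly_Mapping.lookup q m))"
    by (simp add: sum_product meval_sum mono)
  also have "\<dots> = meval h a p * meval h a q"
    by (simp only: mpoly_decompose[symmetric])
  finally show ?thesis .
qed

lemma meval_mconst: "meval h a (mconst c) = h c"
  by (simp add: mconst_def meval_single hom_zero)

lemma meval_one: "meval h a 1 = 1"
  using meval_mconst[of a 1] by (simp add: mconst_def hom_one)

lemma meval_power: "meval h a (p ^ n) = meval h a p ^ n"
  by (induction n) (auto simp: meval_one meval_mult)

lemma meval_prod: "meval h a (prod f S) = (\<Prod>x\<in>S. meval h a (f x))"
  by (induction S rule: infinite_finite_induct) (auto simp: meval_one meval_mult)

lemma meval_mvar: "meval h a (mvar i) = a i"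
proof -
  have "(\<Prod>j\<in>UNIV. a j ^ Poly_Mapping.lookup (Poly_Mapping.single i 1) j) =
      (\<Prod>j\<in>UNIV. if j = i then a j else 1)"
    by (rule prod.cong) (auto simp: lookup_single when_def)
  then show ?thesis
    by (simp add: mvar_def meval_single hom_zero hom_one)
qed

lemma meval_meval:
  "meval h a (meval mconst b p) = meval h (\<lambda>i. meval h a (b i)) p"
  by (simp add: meval_def[of mconst b] meval_def[of h "\<lambda>i. meval h a (b i)"]
      meval_sum meval_mult meval_mconst meval_prod meval_power)

end

lemma coefficient_hom_mconst: "coefficient_hom (mconst :: 'k::comm_ring_1 \<Rightarrow> ('n, 'k) mpoly)"
  by unfold_locales (simp_all add: mconst_def single_add mult_single)

lemma coefficient_hom_id: "coefficient_hom (\<lambda>c :: 'k::comm_ring_1. c)"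
  by unfold_locales simp_all

lemma prod_mvar_power:
  fixes m :: "'n::finite \<Rightarrow>\<^sub>0 nat"
  shows "(\<Prod>i\<in>UNIV. mvar i ^ Poly_Mapping.lookup m i) = Poly_Mapping.single m (1::'k::comm_ring_1)"
proof -
  have pw: "(mvar i :: ('n, 'k) mpoly) ^ n = Poly_Mapping.single (Poly_Mapping.single i n) 1" for i n
    by (induction n) (auto simp: mvar_def mult_single simp flip: single_add)
  have "(\<Prod>i\<in>S. Poly_Mapping.single (f i) 1) = Poly_Mapping.single (\<Sum>i\<in>S. f i) (1::'k)"
    if "finite S" for S and f :: "'n \<Rightarrow> ('n \<Rightarrow>\<^sub>0 nat)"
    using that by induction (auto simp: mult_single)
  moreover have "(\<Sum>i\<in>UNIV. Poly_Mapping.single i (Poly_Mapping.lookup m i)) = m"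
    by (rule poly_mapping_eqI) (simp add: lookup_sum lookup_single when_def)
  ultimately show ?thesis
    by (simp add: pw)
qed

lemma meval_mconst_mvar: "meval mconst mvar p = (p :: ('n::finite, 'k::comm_ring_1) mpoly)"
proof -
  have "meval mconst mvar p =
      (\<Sum>m\<in>Poly_Mapping.keys p. Poly_Mapping.single m (Poly_Mapping.lookup p m))"
    by (simp add: meval_def prod_mvar_power mconst_def mult_single)
  then show ?thesis
    by (simp only: mpoly_decompose[symmetric])
qed

text \<open>
  \<open>g\<cdot>x\<^sub>i\<close> is the linear form \<open>v \<mapsto> x\<^sub>i(g\<inverse>v)\<close>; its coefficient at \<open>x\<^sub>j\<close> is its value at \<open>e\<^sub>j\<close>.
\<close>

definition poly_act ::
    "('g, 'm) monoid_scheme \<Rightarrow> ('k::field \<Rightarrow> 'v::ab_group_add \<Rightarrow> 'v) \<Rightarrow> ('g \<Rightarrow> 'v \<Rightarrow> 'v) \<Rightarrow>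
     ('n::finite \<Rightarrow> 'v) \<Rightarrow> 'g \<Rightarrow> ('n, 'k) mpoly \<Rightarrow> ('n, 'k) mpoly" where
  "poly_act G scale \<rho> e g =
     meval mconst (\<lambda>i. \<Sum>j\<in>UNIV. mconst (coordinate scale e i (\<rho> (inv\<^bsub>G\<^esub> g) (e j))) * mvar j)"

lemma coordinate_sum:
  assumes "linear_representation G scale \<rho>" "indexed_basis scale e"
  shows "(\<Sum>i\<in>UNIV. scale (coordinate scale e i v) (e i)) = v"
proof -
  interpret linear_representation G scale \<rho> by fact
  have inj: "inj e" and ind: "independent (Set.range e)" and sp: "span (Set.range e) = UNIV"
    using assms(2) by (auto simp: indexed_basis_def)
  have "(\<Sum>b\<in>Set.range e. scale (representation (Set.range e) v b) b) = v"
    by (rule sum_representation_eq) (use ind sp in auto)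
  then show ?thesis
    by (simp add: sum.reindex[OF inj] coordinate_def)
qed

lemma coordinate_action:
  assumes "linear_representation G scale \<rho>" "indexed_basis scale e" "g \<in> carrier G"
  shows "coordinate scale e i (\<rho> g v) =
    (\<Sum>j\<in>UNIV. coordinate scale e i (\<rho> g (e j)) * coordinate scale e j v)"
proof -
  interpret linear_representation G scale \<rho> by fact
  have ind: "independent (Set.range e)" and sp: "span (Set.range e) = UNIV"
    using assms(2) by (auto simp: indexed_basis_def)
  interpret L: Vector_Spaces.linear scale scale "\<rho> g"
    using assms(3) by (rule linear_action)
  have "\<rho> g v = \<rho> g (\<Sum>j\<in>UNIV. scale (coordinate scale e j v) (e j))"
    using coordinate_sum[OF assms(1,2)] by simp
  also have "\<dots> = (\<Sum>j\<in>UNIV. scale (coordinate scale e j v) (\<rho> g (e j)))"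
    by (simp add: L.sum L.scale)
  finally have eq: "\<rho> g v = \<dots>" .
  show ?thesis
    unfolding eq by (simp add: coordinate_def representation_sum[OF ind] representation_scale[OF ind]
        sp mult.commute)
qed

text \<open>The defining property \<open>(g\<cdot>p)(v) = p(g\<inverse>v)\<close> of the action.\<close>

lemma poly_act_eval:
  assumes "linear_representation G scale \<rho>" "indexed_basis scale e" "g \<in> carrier G"
  shows "meval (\<lambda>c. c) (\<lambda>i. coordinate scale e i v) (poly_act G scale \<rho> e g p) =
    meval (\<lambda>c. c) (\<lambda>i. coordinate scale e i (\<rho> (inv\<^bsub>G\<^esub> g) v)) p"
proof -
  interpret linear_representation G scale \<rho> by fact
  interpret group_hom G "BijGroup UNIV" \<rho> by (rule group_hom)
  have "inv\<^bsub>G\<^esub> g \<in> carrier G" using assms(3) by simp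
  note act = coordinate_action[OF assms(1,2) this, of _ v]
  interpret E: coefficient_hom "\<lambda>c. c" by (rule coefficient_hom_id)
  show ?thesis
    unfolding poly_act_def E.meval_meval
    by (simp add: E.meval_sum E.meval_mult E.meval_mconst E.meval_mvar act)
qed

lemma poly_act_mult:
  fixes e :: "'b::finite \<Rightarrow> 'c::ab_group_add" and scale :: "'d::field \<Rightarrow> 'c \<Rightarrow> 'c"
  assumes "linear_representation G scale \<rho>" "indexed_basis scale e"
    and gh: "g \<in> carrier G" "h \<in> carrier G"
  shows "poly_act G scale \<rho> e (g \<otimes>\<^bsub>G\<^esub> h) p = poly_act G scale \<rho> e g (poly_act G scale \<rho> e h p)"
proof -
  interpret linear_representation G scale \<rho> by fact
  interpret group_hom G "BijGroup UNIV" \<rho> by (rule group_hom)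
  interpret E: coefficient_hom mconst by (rule coefficient_hom_mconst)
  have "\<rho> (inv\<^bsub>G\<^esub> (g \<otimes>\<^bsub>G\<^esub> h)) v = \<rho> (inv\<^bsub>G\<^esub> h) (\<rho> (inv\<^bsub>G\<^esub> g) v)" for v
    using gh by (simp add: G.inv_mult_group composition_rule del: hom_mult hom_inv)
  moreover have "inv\<^bsub>G\<^esub> h \<in> carrier G" using gh by simp
  ultimately have coeff: "coordinate scale e i (\<rho> (inv\<^bsub>G\<^esub> (g \<otimes>\<^bsub>G\<^esub> h)) v) =
    (\<Sum>j\<in>UNIV. coordinate scale e i (\<rho> (inv\<^bsub>G\<^esub> h) (e j)) * coordinate scale e j (\<rho> (inv\<^bsub>G\<^esub> g) v))" for i v
    using coordinate_action[OF assms(1,2)] by metis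
  have const_sum: "mconst (sum f S) = (\<Sum>x\<in>S. mconst (f x))" for f :: "'b \<Rightarrow> 'd" and S :: "'b set"
    by (induction S rule: infinite_finite_induct) (auto simp: E.hom_zero E.hom_add)
  have inner: "(\<Sum>k\<in>UNIV. mconst (\<Sum>j\<in>UNIV. b j * c j k) * mvar k) =
      (\<Sum>j\<in>UNIV. mconst (b j) * (\<Sum>k\<in>UNIV. mconst (c j k) * mvar k))"
    for b :: "'b \<Rightarrow> 'd" and c :: "'b \<Rightarrow> 'b \<Rightarrow> 'd"
    unfolding const_sum sum_distrib_right sum_distrib_left E.hom_mult mult.assoc
    by (rule sum.swap)
  show ?thesis
    unfolding poly_act_def E.meval_meval coeff
    by (simp only: inner E.meval_sum E.meval_mult E.meval_mconst E.meval_mvar)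
qed

lemma poly_act_one:
  assumes "linear_representation G scale \<rho>" "indexed_basis scale e"
  shows "poly_act G scale \<rho> e \<one>\<^bsub>G\<^esub> p = p"
proof -
  interpret linear_representation G scale \<rho> by fact
  interpret group_hom G "BijGroup UNIV" \<rho> by (rule group_hom)
  interpret E: coefficient_hom mconst by (rule coefficient_hom_mconst)
  have inj: "inj e" and ind: "independent (Set.range e)"
    using assms(2) by (auto simp: indexed_basis_def)
  have one: "\<rho> \<one>\<^bsub>G\<^esub> v = v" for v
    using hom_one by (simp add: BijGroup_def)
  have "coordinate scale e i (e j) = (if i = j then 1 else 0)" for i j
    using inj by (auto simp: coordinate_def representation_basis[OF ind] inj_eq)
  then have "(\<lambda>i. \<Sum>j\<in>UNIV. mconst (coordinate scale e i (\<rho> (inv\<^bsub>G\<^esub> \<one>\<^bsub>G\<^esub>) (e j))) * mvar j) = mvar"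
    by (auto simp: one if_distrib[of mconst] if_distrib[of "\<lambda>x. x * _"]
        E.hom_zero E.hom_one simp del: hom_one cong: if_cong)
  then show ?thesis
    by (simp add: poly_act_def meval_mconst_mvar del: hom_one)
qed

lemma poly_act_eq_0_iff:
  assumes "linear_representation G scale \<rho>" "indexed_basis scale e" "g \<in> carrier G"
  shows "poly_act G scale \<rho> e g p = 0 \<longleftrightarrow> p = 0"
proof -
  interpret linear_representation G scale \<rho> by fact
  interpret group_hom G "BijGroup UNIV" \<rho> by (rule group_hom)
  interpret E: coefficient_hom mconst by (rule coefficient_hom_mconst)
  have 0: "poly_act G scale \<rho> e k 0 = 0" for k
    by (simp add: poly_act_def E.meval_zero)
  have "poly_act G scale \<rho> e (inv\<^bsub>G\<^esub> g) (poly_act G scale \<rho> e g p) = p"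
    using assms poly_act_mult[OF assms(1,2), of "inv\<^bsub>G\<^esub> g" g p] poly_act_one[OF assms(1,2), of p]
    by simp
  then show ?thesis
    using 0 by metis
qed

text \<open>
  \<open>g\<cdot>(a/b) = (g\<cdot>a)/(g\<cdot>b)\<close>, computed from a chosen representative; independence of the choice is
  the lemma \<open>frac_act_Fract\<close> below.
\<close>

definition frac_act ::
    "('g, 'm) monoid_scheme \<Rightarrow> ('k::field \<Rightarrow> 'v::ab_group_add \<Rightarrow> 'v) \<Rightarrow> ('g \<Rightarrow> 'v \<Rightarrow> 'v) \<Rightarrow>
     ('n::{finite, linorder} \<Rightarrow> 'v) \<Rightarrow> 'g \<Rightarrow> ('n, 'k) mpoly fract \<Rightarrow> ('n, 'k) mpoly fract" where
  "frac_act G scale \<rho> e g f =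
     (let (a, b) = (SOME (a, b). b \<noteq> 0 \<and> f = Fract a b)
      in Fract (poly_act G scale \<rho> e g a) (poly_act G scale \<rho> e g b))"

lemma frac_act_Fract:
  assumes "linear_representation G scale \<rho>" "indexed_basis scale e" "g \<in> carrier G" "b \<noteq> 0"
  shows "frac_act G scale \<rho> e g (Fract a b) =
    Fract (poly_act G scale \<rho> e g a) (poly_act G scale \<rho> e g b)"
proof -
  interpret E: coefficient_hom mconst by (rule coefficient_hom_mconst)
  obtain c d where cd: "(SOME (c, d). d \<noteq> 0 \<and> Fract a b = Fract c d) = (c, d)"
    by fastforce
  have "case (SOME (c, d). d \<noteq> 0 \<and> Fract a b = Fract c d) of (c, d) \<Rightarrow> d \<noteq> 0 \<and> Fract a b = Fract c d"
    by (rule someI[of _ "(a, b)"]) (use assms in auto)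
  then have d: "d \<noteq> 0" and "Fract a b = Fract c d"
    unfolding cd by auto
  then have "a * d = c * b"
    using assms(4) by (simp add: eq_fract)
  then have "poly_act G scale \<rho> e g (a * d) = poly_act G scale \<rho> e g (c * b)"
    by (rule arg_cong)
  then have "poly_act G scale \<rho> e g a * poly_act G scale \<rho> e g d =
      poly_act G scale \<rho> e g c * poly_act G scale \<rho> e g b"
    by (simp only: poly_act_def E.meval_mult)
  then show ?thesis
    unfolding frac_act_def cd
    using d assms by (simp add: eq_fract poly_act_eq_0_iff)
qed


section \<open>Invariants and the field Noether number\<close>

definition poly_invariants ::
    "('g, 'm) monoid_scheme \<Rightarrow> ('k::field \<Rightarrow> 'v::ab_group_add \<Rightarrow> 'v) \<Rightarrow> ('g \<Rightarrow> 'v \<Rightarrow> 'v) \<Rightarrow>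
     ('n::finite \<Rightarrow> 'v) \<Rightarrow> ('n, 'k) mpoly set" where
  "poly_invariants G scale \<rho> e = {p. \<forall>g\<in>carrier G. poly_act G scale \<rho> e g p = p}"

definition poly_invariants_le ::
    "('g, 'm) monoid_scheme \<Rightarrow> ('k::field \<Rightarrow> 'v::ab_group_add \<Rightarrow> 'v) \<Rightarrow> ('g \<Rightarrow> 'v \<Rightarrow> 'v) \<Rightarrow>
     ('n::finite \<Rightarrow> 'v) \<Rightarrow> nat \<Rightarrow> ('n, 'k) mpoly set" where
  "poly_invariants_le G scale \<rho> e d = {p \<in> poly_invariants G scale \<rho> e. total_degree p \<le> d}"

definition frac_invariants ::
    "('g, 'm) monoid_scheme \<Rightarrow> ('k::field \<Rightarrow> 'v::ab_group_add \<Rightarrow> 'v) \<Rightarrow> ('g \<Rightarrow> 'v \<Rightarrow> 'v) \<Rightarrow>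
     ('n::{finite, linorder} \<Rightarrow> 'v) \<Rightarrow> ('n, 'k) mpoly fract set" where
  "frac_invariants G scale \<rho> e = {f. \<forall>g\<in>carrier G. frac_act G scale \<rho> e g f = f}"

text \<open>
  The subfield \<open>k(k[V]\<^sup>G\<^sub>\<le>\<^sub>d)\<close> of \<open>k(V)\<close>; it contains \<open>k\<close> because the constants are invariants of
  degree 0.
\<close>

definition low_degree_subfield ::
    "('g, 'm) monoid_scheme \<Rightarrow> ('k::field \<Rightarrow> 'v::ab_group_add \<Rightarrow> 'v) \<Rightarrow> ('g \<Rightarrow> 'v \<Rightarrow> 'v) \<Rightarrow>
     ('n::{finite, linorder} \<Rightarrow> 'v) \<Rightarrow> nat \<Rightarrow> ('n, 'k) mpoly fract set" where
  "low_degree_subfield G scale \<rho> e d =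
     generate_field ring_of_type_algebra ((\<lambda>p. Fract p 1) ` poly_invariants_le G scale \<rho> e d)"

definition gamma_field ::
    "('g, 'm) monoid_scheme \<Rightarrow> ('k::field \<Rightarrow> 'v::ab_group_add \<Rightarrow> 'v) \<Rightarrow> ('g \<Rightarrow> 'v \<Rightarrow> 'v) \<Rightarrow>
     ('n::{finite, linorder} \<Rightarrow> 'v) \<Rightarrow> nat" where
  "gamma_field G scale \<rho> e =
     (LEAST d. ring.finite_dimension ring_of_type_algebra
        (low_degree_subfield G scale \<rho> e d) (frac_invariants G scale \<rho> e))"

end

theory Submission
  imports Defs "HOL-Library.Cardinality"
begin

text \<open>
  Let \<open>d\<close> be the field Noether number. Since \<open>k(V)\<close> is finite over the field generated by the invariants of degree
  at most \<open>d\<close>, a maximal algebraically independent family \<open>f\<close> of such invariants has \<open>N\<close> members.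
  If \<open>\<theta>\<close> is a polynomial with \<open>m = |G|\<close> distinct conjugates, the products of \<open>\<theta>\<^sup>j\<close>, \<open>j < m\<close>, with the
  monomials in \<open>f\<close> are linearly independent over \<open>k\<close>: a relation has invariant coefficients, so it
  is a polynomial of degree less than \<open>m\<close> that vanishes at all \<open>m\<close> conjugates of \<open>\<theta>\<close>. Let \<open>s(t)\<close> be
  the number of monomials of degree at most \<open>t\<close> in \<open>N\<close> variables. Counting dimensions gives
  \<open>m s(t) \<le> s(d t + C)\<close> with a constant \<open>C\<close>, and \<open>s(d t + d - 1) \<le> d\<^sup>N s(t)\<close> by division with
  remainder. Were \<open>m > d\<^sup>N\<close>, the function \<open>s\<close> would grow exponentially; hence \<open>m \<le> d\<^sup>N\<close>.
\<close>


section \<open>Linear and algebraic independence\<close>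

text \<open>It makes the codomain a vector space over the field of coefficients, so that the same
  notions of independence apply to polynomials (\<open>mconst\<close>) and to fractions
  (\<open>mconst\<close> followed by \<open>to_fract\<close>).\<close>

locale coefficient_field = coefficient_hom h
  for h :: "'k::field \<Rightarrow> 'a::idom"
begin

sublocale vs: vector_space "\<lambda>c x. h c * x"
  by unfold_locales (simp_all add: hom_add hom_mult hom_one algebra_simps)

lemma hom_uminus: "h (- c) = - h c"
  using hom_add[of c "- c"] by (simp add: hom_zero add_eq_0_iff)

lemma hom_eq_0_iff: "h c = 0 \<longleftrightarrow> c = 0"
proof
  show "c = 0" if "h c = 0"
  proof (rule ccontr)
    assume "c \<noteq> 0"
    then have "h c * h (inverse c) = 1"
      by (simp add: hom_one flip: hom_mult)
    with that show False by simp
  qed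
qed (simp add: hom_zero)

text \<open>Indexed, so that a repeated value counts as a dependence. It is meant for finite
  \<open>I\<close>: a sum over an infinite set is 0 by default, and the condition then
  fails.\<close>

definition independent_family :: "('i \<Rightarrow> 'a) \<Rightarrow> 'i set \<Rightarrow> bool" where
  "independent_family v I \<longleftrightarrow> (\<forall>c. (\<Sum>i\<in>I. h (c i) * v i) = 0 \<longrightarrow> (\<forall>i\<in>I. c i = 0))"

lemma independent_familyD:
  "independent_family v I \<Longrightarrow> (\<Sum>i\<in>I. h (c i) * v i) = 0 \<Longrightarrow> i \<in> I \<Longrightarrow> c i = 0"
  unfolding independent_family_def by blast

lemma independent_family_subset:
  assumes "independent_family v I" "finite I" "I' \<subseteq> I"
  shows "independent_family v I'"
  unfolding independent_family_def
proof (intro allI impI ballI)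
  fix c i assume 0: "(\<Sum>i\<in>I'. h (c i) * v i) = 0" and i: "i \<in> I'"
  let ?c = "\<lambda>i. if i \<in> I' then c i else 0"
  have "(\<Sum>i\<in>I. h (?c i) * v i) = (\<Sum>i\<in>I'. h (c i) * v i)"
    using assms by (intro sum.mono_neutral_cong_right) (auto simp: hom_zero)
  then show "c i = 0"
    using independent_familyD[OF assms(1), of ?c i] 0 i assms(3) by auto
qed

lemma independent_family_mult:
  assumes "independent_family v I" "z \<noteq> 0"
  shows "independent_family (\<lambda>i. z * v i) I"
proof -
  have "(\<Sum>i\<in>I. h (c i) * (z * v i)) = z * (\<Sum>i\<in>I. h (c i) * v i)" for c
    by (simp add: sum_distrib_left mult_ac)
  then show ?thesis
    using assms by (simp add: independent_family_def)
qed

lemma independent_family_inj_on: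
  assumes "independent_family v I" "finite I"
  shows "inj_on v I"
proof (rule inj_onI, rule ccontr)
  fix i j assume ij: "i \<in> I" "j \<in> I" "v i = v j" "i \<noteq> j"
  have "(\<Sum>k\<in>{i, j}. h (if k = i then 1 else - 1) * v k) = 0"
    using ij by (simp add: hom_one hom_uminus)
  moreover have "independent_family v {i, j}"
    using assms ij by (auto intro: independent_family_subset[of v I "{i, j}"])
  ultimately have "(if i = i then 1 else - 1 :: 'k) = 0"
    using independent_familyD[of v "{i, j}" "\<lambda>k. if k = i then 1 else - 1" i] by blast
  then show False by simp
qed

lemma independent_family_card_le:
  assumes "independent_family v I" "finite I" "finite T" "v ` I \<subseteq> vs.span T"
  shows "card I \<le> card T"
proof -
  have inj: "inj_on v I"
    using assms by (intro independent_family_inj_on)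
  have "vs.independent (v ` I)"
  proof (rule vs.independent_if_scalars_zero)
    fix c x assume 0: "(\<Sum>x\<in>v ` I. h (c x) * x) = 0" and x: "x \<in> v ` I"
    have "(\<Sum>i\<in>I. h (c (v i)) * v i) = 0"
      using 0 by (simp add: sum.reindex[OF inj])
    then show "c x = 0"
      using independent_familyD[OF assms(1), of "\<lambda>i. c (v i)"] x by blast
  qed (use assms in auto)
  then show ?thesis
    using vs.independent_span_bound[OF assms(3) _ assms(4)] card_image[OF inj] by simp
qed

section \<open>Monomials and algebraic independence\<close>

definition monomial :: "'i set \<Rightarrow> ('i \<Rightarrow> 'a) \<Rightarrow> ('i \<Rightarrow> nat) \<Rightarrow> 'a" where
  "monomial J f \<alpha> = (\<Prod>i\<in>J. f i ^ \<alpha> i)"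

text \<open>For finite \<open>J\<close> every polynomial relation has its exponents in some box, so
  this is algebraic independence over the image of \<open>h\<close>. Extensional functions give
  exactly one representative of each exponent vector on \<open>J\<close>.\<close>

definition alg_independent :: "'i set \<Rightarrow> ('i \<Rightarrow> 'a) \<Rightarrow> bool" where
  "alg_independent J f \<longleftrightarrow> (\<forall>t. independent_family (monomial J f) (J \<rightarrow>\<^sub>E {..t}))"

definition monomial_span :: "'i set \<Rightarrow> ('i \<Rightarrow> 'a) \<Rightarrow> nat \<Rightarrow> 'a set" where
  "monomial_span J f t = vs.span (monomial J f ` (J \<rightarrow>\<^sub>E {..t}))"

lemma alg_independent_empty: "alg_independent {} f"
  by (simp add: alg_independent_def independent_family_def monomial_def hom_eq_0_iff)

lemma monomial_restrict: "monomial J f (restrict \<alpha> J) = monomial J f \<alpha>"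
  by (simp add: monomial_def)

lemma monomial_span_hom: "h c \<in> monomial_span J f t"
proof -
  have "monomial J f (\<lambda>i\<in>J. 0) \<in> monomial_span J f t"
    unfolding monomial_span_def by (intro vs.span_base imageI) auto
  then show ?thesis
    using vs.span_scale[of 1 _ c]
    by (simp add: monomial_span_def monomial_restrict) (simp add: monomial_def)
qed

lemma monomial_span_one: "1 \<in> monomial_span J f t"
  using monomial_span_hom[of 1] by (simp add: hom_one)

lemma monomial_span_gen:
  assumes "finite J" "j \<in> J" "t > 0"
  shows "f j \<in> monomial_span J f t"
proof -
  have "monomial J f (\<lambda>i\<in>J. if i = j then 1 else 0) \<in> monomial_span J f t"
    unfolding monomial_span_def using assms by (intro vs.span_base imageI) auto
  moreover have "(\<Prod>i\<in>J. f i ^ (if i = j then 1 else 0)) = (\<Prod>i\<in>J. if i = j then f i else 1)"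
    by (rule prod.cong) auto
  ultimately show ?thesis
    using assms by (simp add: monomial_restrict) (simp add: monomial_def)
qed

text \<open>Multiplication is bilinear, so generators suffice: the left factor is extended to the
  span first, with the right one in \<open>B\<close>, and then the right factor.\<close>

lemma span_times:
  assumes "x \<in> vs.span A" "y \<in> vs.span B" "\<And>a b. a \<in> A \<Longrightarrow> b \<in> B \<Longrightarrow> a * b \<in> vs.span C"
  shows "x * y \<in> vs.span C"
proof -
  have "vs.subspace {x. x * b \<in> vs.span C}" for b
    by (rule vs.subspaceI) (simp_all add: vs.span_zero distrib_right vs.span_add vs.span_scale mult.assoc)
  then have *: "x * b \<in> vs.span C" if "b \<in> B" for b
    using assms(1) vs.span_minimal[of A "{x. x * b \<in> vs.span C}"] assms(3)[OF _ that] by blast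
  have "vs.subspace {y. x * y \<in> vs.span C}"
    by (rule vs.subspaceI)
      (simp_all add: vs.span_zero distrib_left vs.span_add vs.span_scale mult.left_commute[of x])
  then show ?thesis
    using assms(2) vs.span_minimal[of B "{y. x * y \<in> vs.span C}"] * by blast
qed

lemma monomial_mult:
  assumes "\<alpha> \<in> J \<rightarrow>\<^sub>E {..s}" "\<beta> \<in> J \<rightarrow>\<^sub>E {..t}"
  shows "monomial J f \<alpha> * monomial J f \<beta> \<in> monomial J f ` (J \<rightarrow>\<^sub>E {..s + t})"
proof
  show "monomial J f \<alpha> * monomial J f \<beta> = monomial J f (\<lambda>i\<in>J. \<alpha> i + \<beta> i)"
    unfolding monomial_restrict by (simp only: monomial_def power_add prod.distrib)
  show "(\<lambda>i\<in>J. \<alpha> i + \<beta> i) \<in> J \<rightarrow>\<^sub>E {..s + t}"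
    using assms by (auto simp: PiE_iff intro: add_mono)
qed

lemma monomial_span_mult:
  assumes "x \<in> monomial_span J f s" "y \<in> monomial_span J f t"
  shows "x * y \<in> monomial_span J f (s + t)"
  using assms unfolding monomial_span_def
proof (rule span_times)
  fix a b assume "a \<in> monomial J f ` (J \<rightarrow>\<^sub>E {..s})" "b \<in> monomial J f ` (J \<rightarrow>\<^sub>E {..t})"
  then show "a * b \<in> vs.span (monomial J f ` (J \<rightarrow>\<^sub>E {..s + t}))"
    using monomial_mult[of _ J s _ t f] by (auto intro: vs.span_base)
qed

end


section \<open>Finite extensions and transcendence degree\<close>

lemma ring_of_type_algebra_simps [simp]:
  "carrier (ring_of_type_algebra :: 'a::ring_1 ring) = UNIV"
  "x \<otimes>\<^bsub>ring_of_type_algebra\<^esub> y = x * (y :: 'a::ring_1)"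
  "x \<oplus>\<^bsub>ring_of_type_algebra\<^esub> y = x + (y :: 'a::ring_1)"
  "\<one>\<^bsub>ring_of_type_algebra\<^esub> = (1 :: 'a::ring_1)"
  "\<zero>\<^bsub>ring_of_type_algebra\<^esub> = (0 :: 'a::ring_1)"
  by (simp_all add: ring_of_type_algebra_def)

lemma ring_of_type_algebra_uminus [simp]: "\<ominus>\<^bsub>ring_of_type_algebra\<^esub> x = - (x :: 'a::field)"
proof -
  interpret TA: Ring.field "ring_of_type_algebra :: 'a ring" by (rule field_from_type_algebra)
  show ?thesis using TA.minus_equality[of "- x" x] by simp
qed

lemma ring_of_type_algebra_inverse [simp]:
  assumes "x \<noteq> 0"
  shows "inv\<^bsub>ring_of_type_algebra\<^esub> x = inverse (x :: 'a::field)"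
proof -
  interpret TA: Ring.field "ring_of_type_algebra :: 'a ring" by (rule field_from_type_algebra)
  show ?thesis using TA.comm_inv_char[of x "inverse x"] assms by simp
qed

locale field_coefficients = coefficient_field h
  for h :: "'k::field \<Rightarrow> 'a::field"
begin

sublocale TA: Ring.field "ring_of_type_algebra :: 'a ring"
  by (rule field_from_type_algebra)

definition generated_field :: "'i set \<Rightarrow> ('i \<Rightarrow> 'a) \<Rightarrow> 'a set" where
  "generated_field J f = generate_field ring_of_type_algebra (range h \<union> f ` J)"

lemma subfield_generated_field: "subfield (generated_field J f) ring_of_type_algebra"
  unfolding generated_field_def by (rule TA.generate_field_is_subfield) simp

text \<open>Quotients of polynomials in the \<open>f j\<close> are closed under the field
  operations; where two fractions meet, their exponent bounds add up.\<close>

lemma generated_field_quotient: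
  assumes "finite J" "x \<in> generated_field J f"
  shows "\<exists>t a b. a \<in> monomial_span J f t \<and> b \<in> monomial_span J f t \<and> b \<noteq> 0 \<and> x = a / b"
proof -
  let ?quotient = "\<lambda>y. \<exists>t a b. a \<in> monomial_span J f t \<and> b \<in> monomial_span J f t \<and> b \<noteq> 0 \<and> y = a / b"
  have I: "?quotient y" if "a \<in> monomial_span J f t" "b \<in> monomial_span J f t" "b \<noteq> 0" "y = a / b"
    for t a b y
    using that by blast
  show ?thesis
    using assms(2) unfolding generated_field_def
  proof induction
    case one
    show ?case
      by (rule I[of 1 0 1]) (simp_all add: monomial_span_one)
  next
    case (incl x)
    have "x \<in> monomial_span J f 1"
      using incl monomial_span_hom monomial_span_gen[OF assms(1)] by auto
    then show ?case
      by (rule I[of x 1 1]) (simp_all add: monomial_span_one)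
  next
    case (a_inv x)
    then obtain t a b where "a \<in> monomial_span J f t" "b \<in> monomial_span J f t" "b \<noteq> 0" "x = a / b"
      by blast
    then show ?case
      by (intro I[of "- a" t b]) (simp_all add: monomial_span_def vs.span_neg)
  next
    case (m_inv x)
    then obtain t a b where "a \<in> monomial_span J f t" "b \<in> monomial_span J f t" "b \<noteq> 0" "x = a / b"
      by blast
    with m_inv show ?case
      by (intro I[of b t a]) auto
  next
    case (eng_add x y)
    then obtain s a b t c d where
      s: "a \<in> monomial_span J f s" "b \<in> monomial_span J f s" "b \<noteq> 0" "x = a / b" and
      t: "c \<in> monomial_span J f t" "d \<in> monomial_span J f t" "d \<noteq> 0" "y = c / d"
      by blast
    have "a * d \<in> monomial_span J f (s + t)" "b * c \<in> monomial_span J f (s + t)"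
        "b * d \<in> monomial_span J f (s + t)"
      using s t by (auto intro: monomial_span_mult)
    then have "a * d + b * c \<in> monomial_span J f (s + t)" "b * d \<in> monomial_span J f (s + t)"
      by (auto simp: monomial_span_def intro: vs.span_add)
    moreover have "x \<oplus>\<^bsub>ring_of_type_algebra\<^esub> y = (a * d + b * c) / (b * d)" "b * d \<noteq> 0"
      using s t by (auto simp: field_simps)
    ultimately show ?case by blast
  next
    case (eng_mult x y)
    then obtain s a b t c d where
      s: "a \<in> monomial_span J f s" "b \<in> monomial_span J f s" "b \<noteq> 0" "x = a / b" and
      t: "c \<in> monomial_span J f t" "d \<in> monomial_span J f t" "d \<noteq> 0" "y = c / d"
      by blast
    have "a * c \<in> monomial_span J f (s + t)" "b * d \<in> monomial_span J f (s + t)"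
      using s t by (auto intro: monomial_span_mult)
    moreover have "x \<otimes>\<^bsub>ring_of_type_algebra\<^esub> y = (a * c) / (b * d)" "b * d \<noteq> 0"
      using s t by auto
    ultimately show ?case by blast
  qed
qed

text \<open>The denominators are multiplied together. The denominator \<open>c\<close> has to lie in
  the span as well, because a new element \<open>x = a / b\<close> satisfies
  \<open>(c * b) * x = c * a\<close>.\<close>

lemma common_denominator:
  assumes "finite J" "finite Z" "Z \<subseteq> generated_field J f"
  shows "\<exists>t c. c \<noteq> 0 \<and> (\<forall>x\<in>Z. c * x \<in> monomial_span J f t) \<and> c \<in> monomial_span J f t"
  using assms(2,3)
proof induction
  case empty
  show ?case using monomial_span_one by (auto intro!: exI[of _ 1])
next
  case (insert x Z)
  then obtain t c where c: "c \<noteq> 0" "\<forall>x\<in>Z. c * x \<in> monomial_span J f t" "c \<in> monomial_span J f t"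
    by blast
  obtain s a b where a: "a \<in> monomial_span J f s" "b \<in> monomial_span J f s" "b \<noteq> 0" "x = a / b"
    using generated_field_quotient[OF assms(1), of x f] insert by auto
  have "(c * b) * y \<in> monomial_span J f (t + s)" if "y \<in> Z" for y
    using monomial_span_mult[of "c * y" J f t b s] c a that by (simp add: mult_ac)
  moreover have "(c * b) * x \<in> monomial_span J f (t + s)"
    using monomial_span_mult[of c J f t a s] c a by simp
  moreover have "c * b \<in> monomial_span J f (t + s)"
    using monomial_span_mult[of c J f t b s] c a by simp
  ultimately show ?case
    using c a by (intro exI[of _ "t + s"] exI[of _ "c * b"]) auto
qed

text \<open>
  Multiplied by a power of a common denominator of the structure constants, the monomials in the
  \<open>x\<^sub>i\<close> with exponents at most \<open>t\<close> lie in a \<open>k\<close>-space whose dimension grows at most like \<open>t\<close> to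
  the power \<^term>\<open>card J\<close>.
\<close>

lemma alg_independent_card_le:
  fixes x :: "'i \<Rightarrow> 'a" and f :: "'j \<Rightarrow> 'a"
  assumes "finite I" "finite J" "finite B"
    and indep: "alg_independent I x"
    and B: "\<And>y. \<exists>l. l ` B \<subseteq> generated_field J f \<and> y = (\<Sum>b\<in>B. l b * b)"
  shows "card I \<le> card J"
proof (rule ccontr)
  \<comment> \<open>\<open>M t\<close> consists of the combinations of \<open>B\<close> whose
    coefficients are polynomials in \<open>f\<close> with exponents at most \<open>t\<close>; it has
    at most \<open>(t + 1) ^ card J * card B\<close> generators.\<close>
  define M where "M t = vs.span ((\<lambda>(\<beta>, b). monomial J f \<beta> * b) ` ((J \<rightarrow>\<^sub>E {..t}) \<times> B))" for t
  have M_mono: "M s \<subseteq> M t" if "s \<le> t" for s t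
    unfolding M_def using that by (intro vs.span_mono image_mono Sigma_mono PiE_mono) auto
  have M_comb: "(\<Sum>b\<in>B. p b * b) \<in> M t" if "\<And>b. b \<in> B \<Longrightarrow> p b \<in> monomial_span J f t" for p t
    unfolding M_def
  proof (rule vs.span_sum)
    fix b assume b: "b \<in> B"
    show "p b * b \<in> vs.span ((\<lambda>(\<beta>, b). monomial J f \<beta> * b) ` ((J \<rightarrow>\<^sub>E {..t}) \<times> B))"
      by (rule span_times[OF that[OF b, unfolded monomial_span_def], of b "{b}"])
        (use b in \<open>auto intro!: vs.span_base\<close>)
  qed
  obtain l where l: "\<And>y. l y ` B \<subseteq> generated_field J f" "\<And>y. y = (\<Sum>b\<in>B. l y b * b)"
    using B by metis
  \<comment> \<open>\<open>Y\<close> contains every product that has to be expanded over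
    \<open>B\<close> below. Only finitely many coefficients occur, so a single \<open>c\<close>
    clears their denominators, with exponents at most \<open>a\<close>.\<close>
  define Y where "Y = insert 1 (B \<union> (\<lambda>(i, b). x i * b) ` (I \<times> B))"
  have "finite Y" using assms by (simp add: Y_def)
  then have "finite (\<Union>y\<in>Y. l y ` B)" using assms(3) by blast
  moreover have "(\<Union>y\<in>Y. l y ` B) \<subseteq> generated_field J f" using l(1) by blast
  ultimately obtain a c where "c \<noteq> 0" "\<forall>z\<in>(\<Union>y\<in>Y. l y ` B). c * z \<in> monomial_span J f a"
    using common_denominator[OF assms(2)] by meson
  then have "c \<noteq> 0" and c: "c * l y b \<in> monomial_span J f a" if "y \<in> Y" "b \<in> B" for y b
    using that by blast+
  have cY: "c * y = (\<Sum>b\<in>B. (c * l y b) * b)" for y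
    by (subst l(2)[of y]) (simp add: sum_distrib_left mult.assoc)
  \<comment> \<open>Multiplication by such a \<open>z\<close>, later \<open>c\<close> or
    \<open>c * x i\<close>, raises the exponents in \<open>f\<close> by at most
    \<open>a\<close>.\<close>
  have step: "z * u \<in> M (s + a)"
    if z: "\<And>b. b \<in> B \<Longrightarrow> \<exists>y\<in>Y. z * b = c * y" and u: "u \<in> M s" for z u s
  proof -
    have "vs.subspace {u. z * u \<in> M (s + a)}"
      unfolding M_def by (rule vs.subspaceI)
        (simp_all add: vs.span_zero distrib_left vs.span_add vs.span_scale mult.left_commute[of z])
    moreover have "z * (monomial J f \<beta> * b) \<in> M (s + a)" if "\<beta> \<in> J \<rightarrow>\<^sub>E {..s}" "b \<in> B" for \<beta> b
    proof -
      obtain y where y: "y \<in> Y" "z * b = c * y" using z \<open>b \<in> B\<close> by blast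
      have "z * (monomial J f \<beta> * b) = monomial J f \<beta> * (c * y)"
        using y(2) by (simp add: mult.left_commute)
      also have "\<dots> = (\<Sum>b\<in>B. (monomial J f \<beta> * (c * l y b)) * b)"
        by (subst cY) (simp add: sum_distrib_left mult.assoc)
      also have "\<dots> \<in> M (s + a)"
      proof (rule M_comb)
        fix b' assume "b' \<in> B"
        moreover have "monomial J f \<beta> \<in> monomial_span J f s"
          unfolding monomial_span_def using that by (intro vs.span_base) auto
        ultimately show "monomial J f \<beta> * (c * l y b') \<in> monomial_span J f (s + a)"
          using y c by (intro monomial_span_mult) auto
      qed
      finally show ?thesis .
    qed
    ultimately have "M s \<subseteq> {u. z * u \<in> M (s + a)}"
      unfolding M_def[of s] by (intro vs.span_minimal) auto
    then show ?thesis using u by blast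
  qed
  \<comment> \<open>Each variable of the monomial uses up one factor \<open>c\<close>; if the degree
    is at most \<open>n\<close> already, the spare factor is multiplied in alone. The additional
    \<open>c\<close> brings the monomial 1 into \<open>M a\<close>.\<close>
  have mono: "c ^ n * (c * monomial I x \<alpha>) \<in> M (a + n * a)" if "sum \<alpha> I \<le> n" for n \<alpha>
    using that
  proof (induction n arbitrary: \<alpha>)
    case 0
    then have "monomial I x \<alpha> = 1"
      using assms(1) by (simp add: monomial_def)
    moreover have "1 \<in> Y" by (simp add: Y_def)
    then have "c * 1 \<in> M a"
      using c by (subst cY) (intro M_comb, auto)
    ultimately show ?case by simp
  next
    case (Suc n)
    show ?case
    proof (cases "sum \<alpha> I \<le> n")
      case True
      have "c * (c ^ n * (c * monomial I x \<alpha>)) \<in> M (a + n * a + a)"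
        by (rule step) (use Suc.IH[OF True] in \<open>auto simp: Y_def\<close>)
      then show ?thesis by (simp add: mult_ac add_ac)
    next
      case False
      then have "sum \<alpha> I \<noteq> 0" by simp
      then obtain i where i: "i \<in> I" "\<alpha> i \<noteq> 0" using assms(1) by auto
      define \<alpha>' where "\<alpha>' = \<alpha>(i := \<alpha> i - 1)"
      have rest: "sum \<alpha>' (I - {i}) = sum \<alpha> (I - {i})"
          "monomial (I - {i}) x \<alpha>' = monomial (I - {i}) x \<alpha>"
        by (auto simp: \<alpha>'_def monomial_def intro!: sum.cong prod.cong)
      have "sum \<alpha> I = Suc (sum \<alpha>' I)"
        using i assms(1) rest by (simp add: sum.remove[of I i]) (simp add: \<alpha>'_def)
      moreover have "monomial I x \<beta> = x i ^ \<beta> i * monomial (I - {i}) x \<beta>" for \<beta>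
        using i assms(1) by (simp add: monomial_def prod.remove[of I i])
      then have "monomial I x \<alpha> = x i * monomial I x \<alpha>'"
        using i rest by (simp add: \<alpha>'_def flip: power_Suc)
      moreover have "(c * x i) * (c ^ n * (c * monomial I x \<alpha>')) \<in> M (a + n * a + a)"
        by (rule step) (use Suc.IH[of \<alpha>'] Suc.prems i calculation in \<open>auto simp: Y_def mult.assoc\<close>)
      ultimately show ?thesis by (simp add: mult_ac add_ac)
    qed
  qed
  \<comment> \<open>The monomials in the box have degree at most \<open>card I * t\<close> and stay
    independent after multiplication by a power of \<open>c\<close>, so their number is at most that
    of the generators of \<open>M (a + card I * t * a)\<close>.\<close>
  have bound: "(t + 1) ^ card I \<le> (a + card I * t * a + 1) ^ card J * card B" for t
  proof -
    let ?n = "card I * t"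
    let ?T = "(J \<rightarrow>\<^sub>E {..a + ?n * a}) \<times> B"
    have fin: "finite (J \<rightarrow>\<^sub>E {..a + ?n * a})" using assms by (intro finite_PiE) auto
    have sub: "sum \<alpha> I \<le> ?n" if "\<alpha> \<in> I \<rightarrow>\<^sub>E {..t}" for \<alpha>
      using sum_bounded_above[of I \<alpha> t] that by (auto simp: PiE_iff)
    have "card (I \<rightarrow>\<^sub>E {..t}) \<le> card ((\<lambda>(\<beta>, b). monomial J f \<beta> * b) ` ?T)"
    proof (rule independent_family_card_le)
      show "independent_family (\<lambda>\<alpha>. c ^ ?n * c * monomial I x \<alpha>) (I \<rightarrow>\<^sub>E {..t})"
        using indep \<open>c \<noteq> 0\<close> by (intro independent_family_mult) (auto simp: alg_independent_def)
      show "finite (I \<rightarrow>\<^sub>E {..t})" using assms by (intro finite_PiE) auto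
      show "(\<lambda>\<alpha>. c ^ ?n * c * monomial I x \<alpha>) ` (I \<rightarrow>\<^sub>E {..t})
          \<subseteq> vs.span ((\<lambda>(\<beta>, b). monomial J f \<beta> * b) ` ?T)"
        using mono[OF sub] by (auto simp: M_def mult.assoc)
    qed (use fin assms in auto)
    also have "\<dots> \<le> card ?T" using fin assms by (intro card_image_le) auto
    finally show ?thesis using assms by (simp add: card_PiE card_cartesian_product)
  qed
  assume "\<not> card I \<le> card J"
  \<comment> \<open>\<open>D\<close> is chosen so that \<open>a + card I * t * a + 1\<close> is at
    most \<open>D * (t + 1)\<close>. The choice of \<open>t\<close> then bounds the right-hand side
    by \<open>(t + 1) ^ card J * t\<close>, which is less than
    \<open>(t + 1) ^ Suc (card J)\<close>.\<close>
  define D where "D = a + card I * a + 1"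
  define t where "t = D ^ card J * card B"
  have "(t + 1) ^ Suc (card J) \<le> (t + 1) ^ card I"
    using \<open>\<not> card I \<le> card J\<close> by (intro power_increasing) auto
  also have "\<dots> \<le> (a + card I * t * a + 1) ^ card J * card B"
    by (rule bound)
  also have "\<dots> \<le> (D * (t + 1)) ^ card J * card B"
    by (intro mult_right_mono power_mono) (auto simp: D_def algebra_simps)
  also have "\<dots> = (t + 1) ^ card J * t"
    by (simp only: power_mult_distrib) (simp add: t_def mult_ac del: mult_Suc mult_Suc_right add_Suc_right)
  finally show False by simp
qed

end

section \<open>Algebraic elements\<close>

lemma (in domain) algebraic_trans:
  assumes "subfield E R" "subring L R" "x \<in> carrier R"
    and "\<And>y. y \<in> L \<Longrightarrow> (algebraic over E) y" "(algebraic over L) x"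
  shows "(algebraic over E) x"
proof -
  obtain p where p: "p \<in> carrier (univ_poly R L)" "p \<noteq> []" "eval p x = \<zero>"
    using algebraicE[OF assms(2,3,5)] by blast
  then have pL: "set p \<subseteq> L" "hd p \<noteq> \<zero>" by (auto simp: univ_poly_def polynomial_def)
  then have pR: "set p \<subseteq> carrier R" using subringE(1)[OF assms(2)] by blast
  \<comment> \<open>Adjoining just the coefficients of an equation for \<open>x\<close> gives a
    finite extension of \<open>E\<close> over which \<open>x\<close> is still algebraic; the
    resulting tower is finite over \<open>E\<close>.\<close>
  let ?F = "finite_extension E p"
  have F: "subfield ?F R" "finite_dimension E ?F"
    by (rule finite_extension_is_subfield[OF assms(1) pR], use assms(4) pL in blast)
      (rule finite_extension_finite_dimension(1)[OF assms(1) pR], use assms(4) pL in blast)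
  have "set p \<subseteq> ?F"
    using finite_extension_mem[OF subfieldE(1)[OF assms(1)] pR] .
  then have "p \<in> carrier (univ_poly R ?F)"
    using pL by (auto simp: univ_poly_def polynomial_def simp del: finite_extension.simps)
  then have "(algebraic over ?F) x"
    using p by (auto intro: algebraicI)
  then have "finite_dimension ?F (simple_extension ?F x)"
    using finite_dimension_simple_extension F(1) assms(3) by blast
  then have "finite_dimension E (simple_extension ?F x)"
    using telescopic_base_dim(1)[OF assms(1) F] by blast
  then show ?thesis
    using finite_dimension_imp_algebraic[OF assms(1) simple_extension_is_subring[OF subfieldE(1)[OF F(1)] assms(3)]]
      simple_extension_mem[OF subfieldE(1)[OF F(1)] assms(3)] by blast
qed

context field_coefficients
begin

lemma ring_of_type_algebra_pow: "x [^]\<^bsub>ring_of_type_algebra\<^esub> (n::nat) = (x :: 'a) ^ n"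
  by (induction n) (simp_all add: mult.commute)

text \<open>Polynomials in \<open>univ_poly\<close> are lists with the leading coefficient first,
  whence \<open>rev\<close>.\<close>

lemma eval_rev_map: "TA.eval (rev (map a [0..<n])) x = (\<Sum>k<n. a k * x ^ k)"
  by (induction n) (simp_all add: ring_of_type_algebra_pow add.commute)

text \<open>The head of a list in \<open>univ_poly\<close> must be nonzero, so the induction
  discards vanishing top coefficients until a nonzero one leads.\<close>

lemma algebraicI_sum:
  assumes "\<And>n. n < t \<Longrightarrow> a n \<in> E" "(\<Sum>n<t. a n * x ^ n) = 0" "n < t" "a n \<noteq> 0"
  shows "(TA.algebraic over E) x"
  using assms
proof (induction t)
  case (Suc t)
  show ?case
  proof (cases "a t = 0")
    case True
    with Suc.prems have "n < t" by (cases "n = t") auto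
    with Suc True show ?thesis by simp
  next
    case False
    have "a ` {..<Suc t} \<subseteq> E" using Suc.prems by auto
    with False have "rev (map a [0..<Suc t]) \<in> carrier (univ_poly ring_of_type_algebra E)"
      by (auto simp: univ_poly_def polynomial_def)
    then show ?thesis
      by (rule TA.algebraicI) (use Suc.prems(2) in \<open>simp_all only: eval_rev_map ring_of_type_algebra_simps, auto\<close>)
  qed
qed simp

text \<open>A relation that involves the new element \<open>s\<close> becomes an algebraic equation
  for \<open>s\<close> when it is sorted by powers of \<open>s\<close>; independence of
  \<open>f\<close> keeps its coefficients from vanishing altogether.\<close>

lemma alg_independent_maximal:
  assumes "finite J" "i \<notin> J" "alg_independent J f" "\<not> alg_independent (insert i J) (f(i := s))"
  shows "(TA.algebraic over generated_field J f) s"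
proof -
  obtain t c \<alpha> where
    0: "(\<Sum>\<alpha>\<in>insert i J \<rightarrow>\<^sub>E {..t}. h (c \<alpha>) * monomial (insert i J) (f(i := s)) \<alpha>) = 0"
    and \<alpha>: "\<alpha> \<in> insert i J \<rightarrow>\<^sub>E {..t}" "c \<alpha> \<noteq> 0"
    using assms(4) unfolding alg_independent_def independent_family_def by blast
  let ?P = "J \<rightarrow>\<^sub>E {..t}"
  \<comment> \<open>The coefficient of \<open>s ^ n\<close>: an exponent vector on
    \<open>insert i J\<close> is split into its entry \<open>n\<close> at \<open>i\<close> and the
    rest \<open>\<beta>\<close>.\<close>
  define a where "a n = (\<Sum>\<beta>\<in>?P. h (c (\<beta>(i := n))) * monomial J f \<beta>)" for n
  have mon: "monomial (insert i J) (f(i := s)) (\<beta>(i := n)) = s ^ n * monomial J f \<beta>" for \<beta> n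
  proof -
    have "(\<Prod>j\<in>J. (f(i := s)) j ^ (\<beta>(i := n)) j) = (\<Prod>j\<in>J. f j ^ \<beta> j)"
      using assms(2) by (intro prod.cong) auto
    then show ?thesis
      using assms(1,2) by (simp only: monomial_def prod.insert) simp
  qed
  have inj: "inj_on (\<lambda>(n, \<beta>). \<beta>(i := n)) ({..t} \<times> ?P)"
    using inj_combinator[OF assms(2), of "\<lambda>_. {..t}"] by simp
  have "(\<Sum>n<Suc t. a n * s ^ n) = (\<Sum>n\<le>t. \<Sum>\<beta>\<in>?P. h (c (\<beta>(i := n))) * monomial (insert i J) (f(i := s)) (\<beta>(i := n)))"
    by (simp only: lessThan_Suc_atMost a_def mon sum_distrib_right) (simp add: mult_ac)
  also have "\<dots> = 0"
    using 0 unfolding PiE_insert_eq sum.reindex[OF inj]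
    by (simp add: sum.cartesian_product comp_def case_prod_unfold)
  finally have "(\<Sum>n<Suc t. a n * s ^ n) = 0" .
  moreover have "a n \<in> generated_field J f" for n
  proof -
    note K = subfieldE(1)[OF subfield_generated_field[of J f]]
    have mem: "x \<in> generated_field J f" if "x \<in> range h \<union> f ` J" for x
      using that unfolding generated_field_def by (rule generate_field.incl)
    have mult: "x * y \<in> generated_field J f" if "x \<in> generated_field J f" "y \<in> generated_field J f" for x y
      using subringE(6)[OF K that] by simp
    have add: "x + y \<in> generated_field J f" if "x \<in> generated_field J f" "y \<in> generated_field J f" for x y
      using subringE(7)[OF K that] by simp
    have one: "1 \<in> generated_field J f" using subringE(3)[OF K] by simp
    have zero: "0 \<in> generated_field J f" using subringE(2)[OF K] by simp
    have pow: "x ^ n \<in> generated_field J f" if "x \<in> generated_field J f" for x n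
      using that one by (induction n) (auto intro: mult)
    have "(\<Prod>i\<in>J'. f i ^ \<beta> i) \<in> generated_field J f" if "J' \<subseteq> J" for \<beta> J'
      using that by (induction J' rule: infinite_finite_induct) (simp_all add: mult pow mem one)
    then have "h (c (\<beta>(i := n))) * monomial J f \<beta> \<in> generated_field J f" for \<beta>
      unfolding monomial_def by (blast intro: mult mem)
    then have "(\<Sum>\<beta>\<in>A. h (c (\<beta>(i := n))) * monomial J f \<beta>) \<in> generated_field J f" for A
      by (induction A rule: infinite_finite_induct) (auto intro: add zero)
    then show ?thesis
      unfolding a_def .
  qed
  moreover have "a (\<alpha> i) \<noteq> 0"
  proof
    \<comment> \<open>The restriction of \<open>\<alpha>\<close> to \<open>J\<close>, since
      extensional functions are \<open>undefined\<close> outside their domain.\<close>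
    let ?\<beta> = "\<alpha>(i := undefined)"
    assume "a (\<alpha> i) = 0"
    moreover have "independent_family (monomial J f) ?P"
      using assms(3) by (simp add: alg_independent_def)
    moreover have "?\<beta> \<in> ?P" using \<alpha> assms(2) by (auto simp: PiE_iff extensional_def)
    ultimately have "c (?\<beta>(i := \<alpha> i)) = 0"
      using independent_familyD[of "monomial J f" ?P "\<lambda>\<beta>. c (\<beta>(i := \<alpha> i))" ?\<beta>]
      unfolding a_def by blast
    then show False using \<alpha> by simp
  qed
  ultimately show ?thesis
    using \<alpha> by (intro algebraicI_sum[of "Suc t" a _ s "\<alpha> i"]) (auto simp: PiE_iff)
qed

text \<open>Since \<open>Us\<close> has no repetitions, the list of coefficients can be read as a
  function on \<open>set Us\<close>.\<close>

lemma combine_sum: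
  assumes "length Ks = length Us" "distinct Us"
  shows "\<exists>l. l ` set Us \<subseteq> set Ks \<and> TA.combine Ks Us = (\<Sum>u\<in>set Us. l u * u)"
  using assms
proof (induction rule: list_induct2)
  case (Cons k Ks u Us)
  then obtain l where l: "l ` set Us \<subseteq> set Ks" "TA.combine Ks Us = (\<Sum>u\<in>set Us. l u * u)"
    by auto
  have "(\<Sum>v\<in>set Us. (l(u := k)) v * v) = (\<Sum>v\<in>set Us. l v * v)"
    using Cons.prems by (intro sum.cong) auto
  then show ?case
    using l Cons.prems by (intro exI[of _ "l(u := k)"]) auto
qed simp

text \<open>A basis over \<open>generated_field J f\<close> serves as the set \<open>B\<close> of
  \<open>alg_independent_card_le\<close>. The result bounds the transcendence degree of a finite
  extension.\<close>

lemma finite_dimension_card_le: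
  assumes "finite I" "finite J" "alg_independent I x"
    and "TA.finite_dimension (generated_field J f) UNIV"
  shows "card I \<le> card J"
proof -
  let ?E = "generated_field J f"
  obtain n where "TA.dimension n ?E UNIV"
    using assms(4) by (auto simp: TA.finite_dimension_def)
  then obtain Us where Us: "TA.independent ?E Us" "TA.Span ?E Us = UNIV"
    using TA.exists_base[OF subfield_generated_field] by metis
  have "\<exists>l. l ` set Us \<subseteq> ?E \<and> y = (\<Sum>b\<in>set Us. l b * b)" for y
  proof -
    have "y \<in> TA.Span ?E Us" using Us by simp
    then obtain Ks where "set Ks \<subseteq> ?E" "length Ks = length Us" "y = TA.combine Ks Us"
      using TA.Span_mem_iff_length_version[OF subfield_generated_field, of Us y] by auto
    then show ?thesis
      using combine_sum[of Ks Us] TA.independent_distinct[OF subfield_generated_field Us(1)] by blast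
  qed
  then show ?thesis
    using alg_independent_card_le[OF assms(1,2) finite_set assms(3)] by blast
qed

end


section \<open>Degrees of polynomials\<close>

lemma total_degree_le_iff:
  "total_degree p \<le> t \<longleftrightarrow> (\<forall>m\<in>Poly_Mapping.keys p. monom_degree m \<le> t)"
  by (auto simp: total_degree_def)

lemma monom_degree_add: "monom_degree (m + n) = monom_degree m + monom_degree n"
  by (simp add: monom_degree_def lookup_add sum.distrib)

lemma total_degree_mult:
  fixes p q :: "('n::finite, 'k::comm_ring_1) mpoly"
  assumes "total_degree p \<le> s" "total_degree q \<le> t"
  shows "total_degree (p * q) \<le> s + t"
  unfolding total_degree_le_iff
proof
  fix m assume "m \<in> Poly_Mapping.keys (p * q)"
  then obtain a b where "a \<in> Poly_Mapping.keys p" "b \<in> Poly_Mapping.keys q" "m = a + b"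
    using Poly_Mapping.keys_mult[of p q] by auto
  then show "monom_degree m \<le> s + t"
    using assms by (auto simp: total_degree_le_iff monom_degree_add intro: add_mono)
qed

lemma total_degree_add:
  fixes p q :: "('n::finite, 'k::comm_ring_1) mpoly"
  assumes "total_degree p \<le> t" "total_degree q \<le> t"
  shows "total_degree (p + q) \<le> t"
  using assms Poly_Mapping.keys_add[of p q] by (auto simp: total_degree_le_iff)

lemma total_degree_uminus [simp]:
  "total_degree (- p :: ('n::finite, 'k::comm_ring_1) mpoly) = total_degree p"
  by (simp add: total_degree_def)

lemma total_degree_mconst [simp]: "total_degree (mconst c) = 0"
  by (simp add: total_degree_def mconst_def monom_degree_def)

lemma total_degree_zero [simp]: "total_degree 0 = 0"
  by (simp add: total_degree_def)

lemma total_degree_one [simp]: "total_degree (1 :: ('n::finite, 'k::comm_ring_1) mpoly) = 0"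
  using total_degree_mconst[of "1 :: 'k"] by (simp add: mconst_def)

lemma total_degree_mvar: "total_degree (mvar i :: ('n::finite, 'k::comm_ring_1) mpoly) \<le> 1"
  by (simp add: total_degree_le_iff mvar_def monom_degree_def lookup_single when_def)

lemma total_degree_sum:
  fixes f :: "'i \<Rightarrow> ('n::finite, 'k::comm_ring_1) mpoly"
  assumes "\<And>i. i \<in> A \<Longrightarrow> total_degree (f i) \<le> t"
  shows "total_degree (sum f A) \<le> t"
  using assms by (induction A rule: infinite_finite_induct) (auto intro: total_degree_add)

lemma total_degree_prod:
  fixes f :: "'i \<Rightarrow> ('n::finite, 'k::comm_ring_1) mpoly"
  assumes "\<And>i. i \<in> A \<Longrightarrow> total_degree (f i) \<le> d i"
  shows "total_degree (prod f A) \<le> sum d A"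
  using assms by (induction A rule: infinite_finite_induct) (auto intro: total_degree_mult)

lemma total_degree_power:
  fixes p :: "('n::finite, 'k::comm_ring_1) mpoly"
  assumes "total_degree p \<le> t"
  shows "total_degree (p ^ n) \<le> n * t"
  using total_degree_prod[of "{..<n}" "\<lambda>_. p" "\<lambda>_. t"] assms by simp

section \<open>Coefficients of products of linear factors\<close>

lemma coeff_prod_linear_insert:
  fixes a :: "'i \<Rightarrow> 'a::comm_ring_1"
  assumes "finite S" "x \<notin> S"
  shows "coeff (\<Prod>i\<in>insert x S. [:- a i, 1:]) n =
    (case n of 0 \<Rightarrow> 0 | Suc m \<Rightarrow> coeff (\<Prod>i\<in>S. [:- a i, 1:]) m) - a x * coeff (\<Prod>i\<in>S. [:- a i, 1:]) n"
  using assms by (simp add: coeff_pCons split: nat.split)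

text \<open>Up to sign the coefficients are elementary symmetric polynomials in the
  \<open>a i\<close>; each of their terms has at most \<open>card S\<close> factors, of degree at
  most 1.\<close>

lemma total_degree_coeff_prod_linear:
  fixes a :: "'i \<Rightarrow> ('n::finite, 'k::comm_ring_1) mpoly"
  assumes "finite S" "\<And>i. i \<in> S \<Longrightarrow> total_degree (a i) \<le> 1"
  shows "total_degree (coeff (\<Prod>i\<in>S. [:- a i, 1:]) n) \<le> card S"
  using assms
proof (induction arbitrary: n)
  case empty
  show ?case by (cases n) simp_all
next
  case (insert x S)
  have le: "total_degree (coeff (\<Prod>i\<in>S. [:- a i, 1:]) m) \<le> Suc (card S)" for m
    using insert.IH[of m] insert.prems by simp
  moreover have "total_degree (a x * coeff (\<Prod>i\<in>S. [:- a i, 1:]) n) \<le> Suc (card S)"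
    using total_degree_mult[of "a x" 1 _ "card S"] insert by simp
  ultimately show ?case
    unfolding coeff_prod_linear_insert[OF insert.hyps]
    using insert.hyps total_degree_add[of _ "Suc (card S)" "- (a x * coeff (\<Prod>i\<in>S. [:- a i, 1:]) n)"]
    by (auto split: nat.split)
qed

text \<open>The coefficients arise from the \<open>a i\<close> by ring operations. With a group
  element acting as \<open>\<phi>\<close>, this yields the invariance of the coefficients of an
  orbit polynomial.\<close>

lemma hom_coeff_prod_linear:
  fixes a :: "'i \<Rightarrow> 'a::comm_ring_1" and \<phi> :: "'a \<Rightarrow> 'a"
  assumes "finite S" and \<phi>: "coefficient_hom \<phi>"
  shows "\<phi> (coeff (\<Prod>i\<in>S. [:- a i, 1:]) n) = coeff (\<Prod>i\<in>S. [:- \<phi> (a i), 1:]) n"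
  using assms(1)
proof (induction arbitrary: n)
  case empty
  show ?case by (cases n) (simp_all add: coefficient_hom.hom_zero[OF \<phi>] coefficient_hom.hom_one[OF \<phi>])
next
  case (insert x S)
  have "\<phi> (u - v) = \<phi> u - \<phi> v" for u v
    using coefficient_hom.hom_add[OF \<phi>, of "u - v" v] by simp
  then show ?case
    unfolding coeff_prod_linear_insert[OF insert.hyps]
    using insert.IH
    by (simp add: coefficient_hom.hom_mult[OF \<phi>] coefficient_hom.hom_zero[OF \<phi>] split: nat.split)
qed

lemma lookup_Abs_finite:
  fixes \<alpha> :: "'n::finite \<Rightarrow> nat"
  shows "Poly_Mapping.lookup (Abs_poly_mapping \<alpha>) = \<alpha>"
  by (rule lookup_Abs_poly_mapping) simp

lemma coefficient_field_mconst:
  "coefficient_field (mconst :: 'k::field \<Rightarrow> ('n::{finite, linorder}, 'k) mpoly)"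
  by (intro coefficient_field.intro coefficient_hom_mconst)

lemma field_coefficients_to_fract:
  "field_coefficients (\<lambda>c. to_fract (mconst c :: ('n::{finite, linorder}, 'k::field) mpoly))"
proof -
  interpret coefficient_hom "mconst :: 'k \<Rightarrow> ('n, 'k) mpoly" by (rule coefficient_hom_mconst)
  show ?thesis
    by unfold_locales (simp_all add: hom_add hom_mult hom_one)
qed


section \<open>Counting monomials\<close>

text \<open>The exponent vectors of the monomials of total degree at most \<open>t\<close>.\<close>

definition simplex :: "nat \<Rightarrow> ('n::finite \<Rightarrow> nat) set" where
  "simplex t = {\<alpha>. sum \<alpha> UNIV \<le> t}"

lemma simplex_subset_box: "simplex t \<subseteq> UNIV \<rightarrow>\<^sub>E {..t}"
proof
  fix \<alpha> :: "'a \<Rightarrow> nat" assume "\<alpha> \<in> simplex t"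
  then have "\<alpha> i \<le> t" for i
    using member_le_sum[of i UNIV \<alpha>] by (simp add: simplex_def)
  then show "\<alpha> \<in> UNIV \<rightarrow>\<^sub>E {..t}" by auto
qed

lemma simplex_mono: "s \<le> t \<Longrightarrow> simplex s \<subseteq> simplex t"
  by (auto simp: simplex_def)

lemma finite_simplex [simp]: "finite (simplex t)"
  by (rule finite_subset[OF simplex_subset_box]) (intro finite_PiE, auto)

lemma card_simplex_le: "card (simplex t :: ('n::finite \<Rightarrow> nat) set) \<le> (t + 1) ^ CARD('n)"
proof -
  have "card (simplex t :: ('n \<Rightarrow> nat) set) \<le> card ((UNIV :: 'n set) \<rightarrow>\<^sub>E {..t})"
    by (intro card_mono simplex_subset_box finite_PiE) auto
  then show ?thesis by (simp add: card_PiE)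
qed

text \<open>The vectors supported at a single index already number \<open>t + 1\<close>.\<close>

lemma card_simplex_ge: "t < card (simplex t :: ('n::finite \<Rightarrow> nat) set)"
proof -
  fix i :: 'n
  let ?f = "\<lambda>n. (\<lambda>_. 0)(i := n)"
  have "inj_on ?f {..t}"
    by (rule inj_onI) (metis fun_upd_same)
  moreover have "?f ` {..t} \<subseteq> simplex t"
    by (auto simp: simplex_def)
  ultimately have "card {..t} \<le> card (simplex t :: ('n \<Rightarrow> nat) set)"
    by (rule card_inj_on_le) simp
  then show ?thesis by simp
qed

text \<open>Division with remainder by \<open>d\<close> in each coordinate is injective, and there
  are \<open>d ^ CARD('n)\<close> vectors of remainders. The quotients lie in
  \<open>simplex t\<close> because \<open>d\<close> times their sum is less than
  \<open>d * (t + 1)\<close>; this is what permits the offset \<open>d - 1\<close>.\<close>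

lemma card_simplex_dilate:
  assumes "d > 0"
  shows "card (simplex (d * t + d - 1) :: ('n::finite \<Rightarrow> nat) set)
    \<le> d ^ CARD('n) * card (simplex t :: ('n \<Rightarrow> nat) set)"
proof -
  let ?f = "\<lambda>\<alpha> :: 'n \<Rightarrow> nat. (\<lambda>i. \<alpha> i mod d, \<lambda>i. \<alpha> i div d)"
  have "inj ?f"
  proof (rule injI)
    fix \<alpha> \<beta> assume "?f \<alpha> = ?f \<beta>"
    then have "\<alpha> i mod d = \<beta> i mod d" "\<alpha> i div d = \<beta> i div d" for i
      by (auto dest: fun_cong[of _ _ i])
    then show "\<alpha> = \<beta>" by (metis div_mult_mod_eq ext)
  qed
  moreover have "?f ` simplex (d * t + d - 1) \<subseteq> (UNIV \<rightarrow>\<^sub>E {..<d}) \<times> simplex t"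
  proof clarify
    fix \<alpha> :: "'n \<Rightarrow> nat" assume "\<alpha> \<in> simplex (d * t + d - 1)"
    then have "sum \<alpha> UNIV < d * Suc t" using assms by (simp add: simplex_def)
    moreover have "d * (\<Sum>i\<in>UNIV. \<alpha> i div d) \<le> sum \<alpha> UNIV"
      unfolding sum_distrib_left by (intro sum_mono) simp
    ultimately have "d * (\<Sum>i\<in>UNIV. \<alpha> i div d) < d * Suc t" by linarith
    then have "(\<lambda>i. \<alpha> i div d) \<in> simplex t"
      by (simp add: simplex_def less_Suc_eq_le del: mult_Suc_right)
    then show "(\<lambda>i. \<alpha> i mod d) \<in> UNIV \<rightarrow>\<^sub>E {..<d} \<and> (\<lambda>i. \<alpha> i div d) \<in> simplex t"
      using assms by auto
  qed
  ultimately have "card (simplex (d * t + d - 1) :: ('n \<Rightarrow> nat) set) \<le>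
      card (((UNIV :: 'n set) \<rightarrow>\<^sub>E {..<d}) \<times> (simplex t :: ('n \<Rightarrow> nat) set))"
    by (intro card_inj_on_le[of ?f] finite_cartesian_product finite_PiE)
      (auto intro: inj_on_subset)
  then show ?thesis by (simp add: card_cartesian_product card_PiE)
qed

text \<open>If \<open>m > q > 0\<close>, the left side divided by \<open>q ^ i\<close> grows
  exponentially in \<open>i\<close>, against a polynomial bound.\<close>

lemma exponential_bound_imp_le:
  fixes m q C k :: nat
  assumes "\<And>i. m ^ i \<le> q ^ i * (i * C + 1) ^ k"
  shows "m \<le> q"
proof (rule ccontr)
  assume "\<not> m \<le> q"
  show False
  proof (cases "q = 0")
    case True
    then show False using assms[of 1] \<open>\<not> m \<le> q\<close> by simp
  next
    case False
    \<comment> \<open>At the exponent \<open>i = q y (k + 1)\<close>, Bernoulli's inequality gives \<open>(1 + 1/q)\<^sup>i \<ge> (1 + y)\<^sup>k\<^sup>+\<^sup>1\<close>, while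
      the hypothesis bounds the left-hand side by \<open>(D (1 + y))\<^sup>k\<close>.\<close>
    define D where "D = q * Suc k * C + 1"
    \<comment> \<open>This value turns \<open>(D * (1 + y)) ^ k\<close> into
      \<open>y * (1 + y) ^ k\<close>, which is less than \<open>(1 + y) ^ Suc k\<close>.\<close>
    define y where "y = D ^ k"
    define r where "r = real (q + 1) / real q"
    have "real (1 + y) = 1 + real (q * y) * (1 / real q)"
      using False by simp
    also have "\<dots> \<le> (1 + 1 / real q) ^ (q * y)"
      by (rule Bernoulli_inequality) (use False in \<open>simp add: field_simps\<close>)
    also have "1 + 1 / real q = r"
      using False by (simp add: r_def field_simps)
    finally have "real (1 + y) ^ Suc k \<le> (r ^ (q * y)) ^ Suc k"
      by (intro power_mono) auto
    also have "\<dots> = r ^ (q * y * Suc k)"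
      by (simp only: power_mult)
    also have "\<dots> \<le> real ((q * y * Suc k * C + 1) ^ k)"
    proof -
      let ?i = "q * y * Suc k"
      have "(q + 1) ^ ?i \<le> m ^ ?i" using \<open>\<not> m \<le> q\<close> by (intro power_mono) auto
      also have "\<dots> \<le> q ^ ?i * (?i * C + 1) ^ k" by (rule assms)
      finally have "real ((q + 1) ^ ?i) \<le> real (q ^ ?i * (?i * C + 1) ^ k)"
        by (simp only: of_nat_le_iff)
      then show ?thesis
        unfolding r_def power_divide using False
        by (simp only: of_nat_power of_nat_mult divide_le_eq) (simp add: mult.commute)
    qed
    also have "\<dots> \<le> real ((D * (1 + y)) ^ k)"
      unfolding of_nat_le_iff by (intro power_mono) (auto simp: D_def algebra_simps)
    also have "\<dots> = real (y * (1 + y) ^ k)"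
      by (simp only: power_mult_distrib y_def)
    finally have "(1 + y) ^ Suc k \<le> y * (1 + y) ^ k"
      by (simp only: of_nat_power[symmetric] of_nat_le_iff)
    then show False by simp
  qed
qed

lemma card_simplex_imp_le_power:
  assumes "\<And>t. m * card (simplex t :: ('n::finite \<Rightarrow> nat) set) \<le> card (simplex (d * t + C) :: ('n \<Rightarrow> nat) set)"
    and "m > 0"
  shows "m \<le> d ^ CARD('n)"
proof (cases "d = 0")
  case True
  let ?s = "\<lambda>t. card (simplex t :: ('n \<Rightarrow> nat) set)"
  \<comment> \<open>For \<open>d = 0\<close> the hypothesis bounds all values of \<open>?s\<close>
    by \<open>?s C\<close>, although \<open>?s\<close> is unbounded.\<close>
  have "?s C < ?s (?s C)" by (rule card_simplex_ge)
  also have "\<dots> \<le> m * ?s (?s C)" using assms(2) by simp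
  also have "\<dots> \<le> ?s C" using assms(1)[of "?s C"] True by simp
  finally show ?thesis by simp
next
  case False
  let ?s = "\<lambda>t. card (simplex t :: ('n \<Rightarrow> nat) set)"
  \<comment> \<open>Replacing \<open>t\<close> by \<open>t + C\<close> on the right absorbs the
    constant, so a factor \<open>m\<close> costs a factor \<open>d ^ CARD('n)\<close> and a shift by
    \<open>C\<close>.\<close>
  have step: "m * ?s t \<le> d ^ CARD('n) * ?s (t + C)" for t
  proof -
    have "C \<le> d * C" using False by simp
    then have "d * t + C \<le> d * t + d * C" by (rule add_left_mono)
    also have "\<dots> \<le> d * (t + C) + d - 1" using False by (simp add: distrib_left)
    finally have le: "d * t + C \<le> d * (t + C) + d - 1" .
    have "m * ?s t \<le> ?s (d * t + C)" by (rule assms(1))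
    also have "\<dots> \<le> ?s (d * (t + C) + d - 1)"
      by (intro card_mono finite_simplex simplex_mono le)
    also have "\<dots> \<le> d ^ CARD('n) * ?s (t + C)"
      using False by (intro card_simplex_dilate) simp
    finally show ?thesis .
  qed
  \<comment> \<open>The step is iterated from \<open>t = 0\<close>. The shifts only add up to
    \<open>i * C\<close>, where \<open>?s\<close> is bounded by a polynomial in
    \<open>i\<close>.\<close>
  have "m ^ i * ?s 0 \<le> (d ^ CARD('n)) ^ i * ?s (i * C)" for i
  proof (induction i)
    case (Suc i)
    have "m ^ Suc i * ?s 0 \<le> m * ((d ^ CARD('n)) ^ i * ?s (i * C))"
      using Suc by simp
    also have "\<dots> = (d ^ CARD('n)) ^ i * (m * ?s (i * C))" by (rule mult.left_commute)
    also have "\<dots> \<le> (d ^ CARD('n)) ^ i * (d ^ CARD('n) * ?s (i * C + C))"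
      by (intro mult_le_mono2 step)
    finally show ?case by (simp add: mult_ac add.commute)
  qed simp
  moreover have "m ^ i \<le> m ^ i * ?s 0" for i
    using mult_le_mono2[of 1 "?s 0" "m ^ i"] card_simplex_ge[of 0, where 'n = 'n] by linarith
  moreover have "(d ^ CARD('n)) ^ i * ?s (i * C) \<le> (d ^ CARD('n)) ^ i * (i * C + 1) ^ CARD('n)" for i
    by (intro mult_le_mono2 card_simplex_le)
  ultimately have "m ^ i \<le> (d ^ CARD('n)) ^ i * (i * C + 1) ^ CARD('n)" for i
    by (meson order_trans)
  then show ?thesis by (rule exponential_bound_imp_le)
qed


section \<open>Invariants of a finite group\<close>

lemma to_fract_power: "to_fract (p ^ n) = to_fract p ^ n"
  by (induction n) simp_all

lemma to_fract_sum: "to_fract (sum f A) = (\<Sum>x\<in>A. to_fract (f x))"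
  by (induction A rule: infinite_finite_induct) simp_all

lemma to_fract_prod: "to_fract (prod f A) = (\<Prod>x\<in>A. to_fract (f x))"
  by (induction A rule: infinite_finite_induct) simp_all

locale finite_faithful_representation =
  fixes G :: "('g, 'm) monoid_scheme" (structure)
    and scale :: "'k::field \<Rightarrow> 'v::ab_group_add \<Rightarrow> 'v"
    and \<rho> :: "'g \<Rightarrow> 'v \<Rightarrow> 'v"
    and e :: "'n::{finite, linorder} \<Rightarrow> 'v"
  assumes finite_group: "finite (carrier G)"
    and representation: "linear_representation G scale \<rho>"
    and faithful_rep: "faithful_action G UNIV \<rho>"
    and basis: "indexed_basis scale e"
begin

sublocale rep: linear_representation G scale \<rho>
  by (rule representation)

sublocale rho: group_hom G "BijGroup UNIV" \<rho>
  by (rule rep.group_hom)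

sublocale M: coefficient_field "mconst :: 'k \<Rightarrow> ('n, 'k) mpoly"
  by (rule coefficient_field_mconst)

sublocale F: field_coefficients "\<lambda>c. to_fract (mconst c :: ('n, 'k) mpoly)"
  by (rule field_coefficients_to_fract)

abbreviation act :: "'g \<Rightarrow> ('n, 'k) mpoly \<Rightarrow> ('n, 'k) mpoly" where
  "act g \<equiv> poly_act G scale \<rho> e g"

abbreviation fract_action :: "'g \<Rightarrow> ('n, 'k) mpoly fract \<Rightarrow> ('n, 'k) mpoly fract" where
  "fract_action g \<equiv> frac_act G scale \<rho> e g"

abbreviation low_invariants :: "nat \<Rightarrow> ('n, 'k) mpoly set" where
  "low_invariants d \<equiv> poly_invariants_le G scale \<rho> e d"

abbreviation fixed_field :: "('n, 'k) mpoly fract set" where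
  "fixed_field \<equiv> frac_invariants G scale \<rho> e"

abbreviation low_subfield :: "nat \<Rightarrow> ('n, 'k) mpoly fract set" where
  "low_subfield d \<equiv> low_degree_subfield G scale \<rho> e d"

lemmas act_mult = poly_act_mult[OF representation basis]
lemmas act_one = poly_act_one[OF representation basis]

lemma coefficient_hom_act: "coefficient_hom (act g)"
  by unfold_locales (simp_all add: poly_act_def M.meval_add M.meval_mult M.meval_one)

lemma act_mconst: "act g (mconst c) = mconst c"
  by (simp add: poly_act_def M.meval_mconst)

lemma act_sum: "act g (sum f A) = (\<Sum>x\<in>A. act g (f x))"
  by (simp add: poly_act_def M.meval_sum)

lemma act_prod: "act g (prod f A) = (\<Prod>x\<in>A. act g (f x))"
  by (simp add: poly_act_def M.meval_prod)

lemma act_power: "act g (p ^ n) = act g p ^ n"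
  by (simp add: poly_act_def M.meval_power)

lemmas act_add = coefficient_hom.hom_add[OF coefficient_hom_act]
lemmas act_times = coefficient_hom.hom_mult[OF coefficient_hom_act]

lemma total_degree_act_mvar: "total_degree (act g (mvar i)) \<le> 1"
proof -
  have "total_degree (mconst c * mvar j :: ('n, 'k) mpoly) \<le> 0 + 1" for c j
    by (intro total_degree_mult total_degree_mvar) simp
  then show ?thesis
    by (auto simp: poly_act_def M.meval_mvar intro!: total_degree_sum)
qed

lemma order_pos: "Coset.order G > 0"
  using finite_group rho.G.order_gt_0_iff_finite by blast

section \<open>Orbit polynomials of the coordinates\<close>

definition orbit_poly :: "'n \<Rightarrow> ('n, 'k) mpoly poly" where
  "orbit_poly i = (\<Prod>g\<in>carrier G. [:- act g (mvar i), 1:])"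

text \<open>A group element permutes the factors of the product and hence fixes its coefficients;
  the degree bound comes from the |G| linear factors.\<close>

lemma coeff_orbit_poly: "coeff (orbit_poly i) n \<in> low_invariants (Coset.order G)"
proof -
  have "act g (coeff (orbit_poly i) n) = coeff (orbit_poly i) n" if g: "g \<in> carrier G" for g
  proof -
    have "act g (coeff (orbit_poly i) n) = coeff (\<Prod>h\<in>carrier G. [:- act g (act h (mvar i)), 1:]) n"
      unfolding orbit_poly_def by (rule hom_coeff_prod_linear[OF finite_group coefficient_hom_act])
    also have "(\<Prod>h\<in>carrier G. [:- act g (act h (mvar i)), 1:]) = (\<Prod>h\<in>carrier G. [:- act (g \<otimes> h) (mvar i), 1:])"
      using g by (intro prod.cong) (auto simp: act_mult)
    also have "\<dots> = orbit_poly i"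
      unfolding orbit_poly_def
      by (rule prod.reindex_bij_witness[of _ "\<lambda>h. inv g \<otimes> h" "\<lambda>h. g \<otimes> h"])
        (use g in \<open>auto simp: rho.G.m_assoc[symmetric]\<close>)
    finally show ?thesis .
  qed
  moreover have "total_degree (coeff (orbit_poly i) n) \<le> Coset.order G"
    unfolding orbit_poly_def Coset.order_def
    by (rule total_degree_coeff_prod_linear[OF finite_group total_degree_act_mvar])
  ultimately show ?thesis
    by (simp add: poly_invariants_le_def poly_invariants_def)
qed

lemma orbit_poly_nonzero: "orbit_poly i \<noteq> 0"
  using finite_group by (simp add: orbit_poly_def)

lemma poly_orbit_poly: "poly (orbit_poly i) (mvar i) = 0"
proof -
  have "(\<Prod>g\<in>carrier G. mvar i - act g (mvar i)) = 0"
    using finite_group by (intro prod_zero) (auto intro!: bexI[of _ "\<one>"] simp: act_one)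
  then show ?thesis by (simp add: orbit_poly_def poly_prod)
qed

text \<open>The orbit polynomial is an equation for the coordinate. The set \<open>L\<close> is
  general because both \<open>low_subfield\<close> and \<open>fixed_field\<close> take its place
  later.\<close>

lemma mvar_algebraic:
  assumes "to_fract ` low_invariants (Coset.order G) \<subseteq> L"
  shows "(F.TA.algebraic over L) (to_fract (mvar i))"
proof (rule F.algebraicI_sum)
  let ?P = "orbit_poly i"
  show "to_fract (coeff ?P n) \<in> L" for n
    using coeff_orbit_poly[of i n] assms by blast
  have "(\<Sum>n<Suc (degree ?P). to_fract (coeff ?P n) * to_fract (mvar i) ^ n) =
      (\<Sum>n\<le>degree ?P. to_fract (coeff ?P n * mvar i ^ n))"
    by (simp only: lessThan_Suc_atMost to_fract_mult to_fract_power)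
  also have "\<dots> = to_fract (poly ?P (mvar i))"
    by (simp only: poly_altdef to_fract_sum)
  finally show "(\<Sum>n<Suc (degree ?P). to_fract (coeff ?P n) * to_fract (mvar i) ^ n) = 0"
    by (simp only: poly_orbit_poly to_fract_0)
  show "degree ?P < Suc (degree ?P)" "to_fract (coeff ?P (degree ?P)) \<noteq> 0"
    using orbit_poly_nonzero by simp_all
qed

text \<open>Adjoining the finitely many algebraic coordinates to \<open>L\<close> gives a finite
  extension \<open>K\<close>. It contains constants and coordinates, therefore all polynomials,
  therefore all fractions.\<close>

lemma finite_dimension_if_mvar_algebraic:
  assumes L: "subfield L ring_of_type_algebra" and "range (\<lambda>c. to_fract (mconst c)) \<subseteq> L"
    and "\<And>i. (F.TA.algebraic over L) (to_fract (mvar i :: ('n, 'k) mpoly))"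
  shows "F.TA.finite_dimension L (UNIV :: ('n, 'k) mpoly fract set)"
proof -
  obtain xs where xs: "set xs = range (\<lambda>i. to_fract (mvar i :: ('n, 'k) mpoly))"
    using finite_list[of "range (\<lambda>i. to_fract (mvar i :: ('n, 'k) mpoly))"] by auto
  define K where "K = F.TA.finite_extension L xs"
  have xsR: "set xs \<subseteq> carrier ring_of_type_algebra" by simp
  have subK: "subfield K ring_of_type_algebra"
    unfolding K_def by (rule F.TA.finite_extension_is_subfield[OF L xsR]) (use assms(3) xs in auto)
  note R = subfieldE(1)[OF subK]
  have LK: "L \<subseteq> K" unfolding K_def by (rule F.TA.finite_extension_incl) simp_all
  have mult: "x * y \<in> K" if "x \<in> K" "y \<in> K" for x y
    using subringE(6)[OF R that] by simp
  have add: "x + y \<in> K" if "x \<in> K" "y \<in> K" for x y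
    using subringE(7)[OF R that] by simp
  have zero: "0 \<in> K" and one: "1 \<in> K"
    using subringE(2,3)[OF R] by simp_all
  have pow: "x ^ n \<in> K" if "x \<in> K" for x n
    using that one by (induction n) (auto intro: mult)
  have mvar: "to_fract (mvar i) \<in> K" for i
    using F.TA.finite_extension_mem[OF subfieldE(1)[OF L] xsR] xs unfolding K_def by blast
  have prod: "(\<Prod>i\<in>A. to_fract (mvar i) ^ m i) \<in> K" for A m
    by (induction A rule: infinite_finite_induct) (simp_all add: one mult pow mvar)
  have monom: "to_fract (mconst c) * (\<Prod>i\<in>UNIV. to_fract (mvar i) ^ m i) \<in> K" for c m
    using prod LK assms(2) by (blast intro: mult)
  have P: "to_fract p \<in> K" for p
  proof -
    have "(\<Sum>m\<in>A. to_fract (mconst (Poly_Mapping.lookup p m)) *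
        (\<Prod>i\<in>UNIV. to_fract (mvar i) ^ Poly_Mapping.lookup m i)) \<in> K" for A
      by (induction A rule: infinite_finite_induct)
        (simp_all add: zero add monom)
    also have "(\<Sum>m\<in>Poly_Mapping.keys p. to_fract (mconst (Poly_Mapping.lookup p m)) *
        (\<Prod>i\<in>UNIV. to_fract (mvar i) ^ Poly_Mapping.lookup m i)) = to_fract (meval mconst mvar p)"
      by (simp add: meval_def to_fract_sum to_fract_prod to_fract_power)
    finally show ?thesis by (simp only: meval_mconst_mvar)
  qed
  have "x \<in> K" for x
  proof -
    obtain a b where x: "x = Fract a b" "b \<noteq> 0" by (cases x) auto
    have "inv\<^bsub>ring_of_type_algebra\<^esub> (to_fract b) \<in> K"
      using F.TA.subfield_m_inv(1)[OF subK, of "to_fract b"] x P by simp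
    then have "to_fract a * inverse (to_fract b) \<in> K"
      using x P by (intro mult) auto
    then show ?thesis using x by (simp only: Fract_conv_to_fract divide_inverse)
  qed
  then have "K = UNIV" by blast
  moreover have "F.TA.finite_dimension L K"
    unfolding K_def by (rule F.TA.finite_extension_finite_dimension(1)[OF L xsR]) (use assms(3) xs in auto)
  ultimately show ?thesis by (simp only:)
qed

lemma subfield_low_subfield: "subfield (low_subfield d) ring_of_type_algebra"
  unfolding low_degree_subfield_def by (rule F.TA.generate_field_is_subfield) simp

lemma low_invariants_subset_low_subfield: "to_fract ` low_invariants d \<subseteq> low_subfield d"
  unfolding low_degree_subfield_def to_fract_def by (auto intro: generate_field.incl)

lemma mconst_low_invariants: "mconst c \<in> low_invariants d"
  by (simp add: poly_invariants_le_def poly_invariants_def act_mconst)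

lemma finite_dimension_low_subfield_order:
  "F.TA.finite_dimension (low_subfield (Coset.order G)) (UNIV :: ('n, 'k) mpoly fract set)"
  using low_invariants_subset_low_subfield mconst_low_invariants
  by (intro finite_dimension_if_mvar_algebraic subfield_low_subfield mvar_algebraic) blast+

section \<open>The action on fractions and the fixed field\<close>

lemma
  assumes "g \<in> carrier G"
  shows fract_action_add: "fract_action g (x + y) = fract_action g x + fract_action g y"
    and fract_action_mult: "fract_action g (x * y) = fract_action g x * fract_action g y"
proof -
  obtain a b c d where *: "x = Fract a b" "b \<noteq> 0" "y = Fract c d" "d \<noteq> 0"
    by (cases x; cases y) auto
  then have "act g b \<noteq> 0" "act g d \<noteq> 0"
    using poly_act_eq_0_iff[OF representation basis assms] by auto
  then show "fract_action g (x + y) = fract_action g x + fract_action g y" "fract_action g (x * y) = fract_action g x * fract_action g y"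
    using * by (simp_all add: frac_act_Fract[OF representation basis assms] act_add act_times)
qed

lemma fract_action_to_fract:
  assumes "g \<in> carrier G"
  shows "fract_action g (to_fract p) = to_fract (act g p)"
  using frac_act_Fract[OF representation basis assms, of 1 p]
  by (simp add: to_fract_def coefficient_hom.hom_one[OF coefficient_hom_act])

lemma to_fract_in_fixed_field: "p \<in> low_invariants d \<Longrightarrow> to_fract p \<in> fixed_field"
  by (simp add: frac_invariants_def fract_action_to_fract poly_invariants_le_def poly_invariants_def)

lemma subfield_fixed_field: "subfield fixed_field ring_of_type_algebra"
proof -
  have one: "fract_action g 1 = 1" if "g \<in> carrier G" for g
    using fract_action_to_fract[OF that, of 1] by (simp add: coefficient_hom.hom_one[OF coefficient_hom_act])
  have zero: "fract_action g 0 = 0" if "g \<in> carrier G" for g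
    using fract_action_to_fract[OF that, of 0] by (simp add: coefficient_hom.hom_zero[OF coefficient_hom_act])
  have minus: "fract_action g (- x) = - fract_action g x" if "g \<in> carrier G" for g x
    using fract_action_add[OF that, of x "- x"] zero[OF that] by (simp add: add_eq_0_iff)
  have inverse: "fract_action g (inverse x) = inverse (fract_action g x)" if "g \<in> carrier G" "x \<noteq> 0" for g x
  proof -
    have "fract_action g x * fract_action g (inverse x) = 1"
      using fract_action_mult[OF that(1), of x "inverse x"] one[OF that(1)] that(2) by simp
    then show ?thesis by (simp add: inverse_unique)
  qed
  show ?thesis
  proof (rule F.TA.subfieldI'[OF F.TA.subringI])
    show "inv\<^bsub>ring_of_type_algebra\<^esub> x \<in> fixed_field"
      if "x \<in> fixed_field - {\<zero>\<^bsub>ring_of_type_algebra\<^esub>}" for x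
      using that by (simp add: frac_invariants_def inverse)
  qed (auto simp: frac_invariants_def one minus fract_action_add fract_action_mult)
qed

lemma low_subfield_subset_fixed_field: "low_subfield d \<subseteq> fixed_field"
  unfolding low_degree_subfield_def
  by (rule F.TA.generate_field_min_subfield1[OF _ subfield_fixed_field])
    (use to_fract_in_fixed_field in \<open>auto simp: to_fract_def\<close>)

text \<open>The minimum is attained because |G| qualifies: the whole field is finite over
  \<open>low_subfield (Coset.order G)\<close>, and so is the fixed field between them.\<close>

lemma finite_dimension_gamma_field:
  "F.TA.finite_dimension (low_subfield (gamma_field G scale \<rho> e)) fixed_field"
  unfolding gamma_field_def
proof (rule LeastI)
  note K = subfield_fixed_field
  have "subalgebra (low_subfield (Coset.order G)) fixed_field ring_of_type_algebra"
    using subring.axioms(1)[OF subfieldE(1)[OF K]] subringE(6)[OF subfieldE(1)[OF K]]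
      low_subfield_subset_fixed_field
    by (auto simp: subalgebra_def subalgebra_axioms_def)
  then show "F.TA.finite_dimension (low_subfield (Coset.order G)) fixed_field"
    by (rule F.TA.subalbegra_incl_imp_finite_dimension[OF subfield_low_subfield finite_dimension_low_subfield_order]) simp
qed

section \<open>Algebraically independent invariants\<close>

lemma alg_independent_to_fract:
  "F.alg_independent J (\<lambda>i. to_fract (f i)) \<longleftrightarrow> M.alg_independent J f"
proof -
  have "(\<Sum>\<alpha>\<in>A. to_fract (mconst (c \<alpha>)) * F.monomial J (\<lambda>i. to_fract (f i)) \<alpha>) =
      to_fract (\<Sum>\<alpha>\<in>A. mconst (c \<alpha>) * M.monomial J f \<alpha>)" for A c
    by (simp add: F.monomial_def M.monomial_def to_fract_sum to_fract_prod to_fract_power)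
  \<comment> \<open>By injectivity of \<open>to_fract\<close> the relations are the same on both
    sides. Extensions are studied among fractions, degrees among polynomials.\<close>
  then show ?thesis
    by (simp only: F.alg_independent_def M.alg_independent_def F.independent_family_def
        M.independent_family_def to_fract_eq_0_iff)
qed

lemma monomial_mvar:
  "M.monomial UNIV mvar \<alpha> = Poly_Mapping.single (Abs_poly_mapping \<alpha>) (1 :: 'k)"
  using prod_mvar_power[of "Abs_poly_mapping \<alpha>"] by (simp add: M.monomial_def lookup_Abs_finite)

text \<open>Distinct exponent vectors give distinct monomials, so the coefficient of the sum at the
  exponent vector \<open>\<alpha>\<close> is \<open>c \<alpha>\<close>.\<close>

lemma alg_independent_mvar: "M.alg_independent UNIV (mvar :: 'n \<Rightarrow> _)"
  unfolding M.alg_independent_def M.independent_family_def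
proof (intro allI impI ballI)
  fix t c and \<alpha> :: "'n \<Rightarrow> nat"
  assume 0: "(\<Sum>\<alpha>\<in>UNIV \<rightarrow>\<^sub>E {..t}. mconst (c \<alpha>) * M.monomial UNIV mvar \<alpha>) = 0"
    and \<alpha>: "\<alpha> \<in> UNIV \<rightarrow>\<^sub>E {..t}"
  have fin: "finite ((UNIV :: 'n set) \<rightarrow>\<^sub>E {..t})" by (intro finite_PiE) auto
  have inj: "Abs_poly_mapping \<beta> = Abs_poly_mapping \<alpha> \<longleftrightarrow> \<beta> = \<alpha>" for \<beta> :: "'n \<Rightarrow> nat"
    by (metis lookup_Abs_finite)
  have "0 = Poly_Mapping.lookup (\<Sum>\<alpha>\<in>UNIV \<rightarrow>\<^sub>E {..t}. mconst (c \<alpha>) * M.monomial UNIV mvar \<alpha>)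
      (Abs_poly_mapping \<alpha>)"
    by (simp add: 0)
  also have "\<dots> = (\<Sum>\<beta>\<in>UNIV \<rightarrow>\<^sub>E {..t}. if \<beta> = \<alpha> then c \<beta> else 0)"
    by (simp add: lookup_sum monomial_mvar mconst_def mult_single lookup_single when_def inj)
  also have "\<dots> = c \<alpha>" using \<alpha> fin by simp
  finally show "c \<alpha> = 0" by simp
qed

lemma span_total_degree:
  assumes "total_degree p \<le> t"
  shows "p \<in> M.vs.span (M.monomial UNIV mvar ` simplex t)"
proof -
  have "meval mconst mvar p \<in> M.vs.span (M.monomial UNIV mvar ` simplex t)"
    unfolding meval_def
  proof (intro M.vs.span_sum M.vs.span_scale M.vs.span_base)
    fix m assume "m \<in> Poly_Mapping.keys p"
    then have "Poly_Mapping.lookup m \<in> simplex t"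
      using assms by (simp add: total_degree_le_iff monom_degree_def simplex_def)
    then show "(\<Prod>i\<in>UNIV. mvar i ^ Poly_Mapping.lookup m i) \<in> M.monomial UNIV mvar ` simplex t"
      by (auto simp: M.monomial_def)
  qed
  then show ?thesis by (simp only: meval_mconst_mvar)
qed

lemma exists_alg_independent:
  assumes "F.TA.finite_dimension (low_subfield d) fixed_field"
  shows "\<exists>f. range f \<subseteq> low_invariants d \<and> M.alg_independent (UNIV :: 'n set) f"
proof -
  \<comment> \<open>Families are indexed by subsets of the finite type \<open>'n\<close>, so a
    maximal one exists and it remains to show that its index set is everything.\<close>
  let ?C = "{J :: 'n set. \<exists>f. f ` J \<subseteq> low_invariants d \<and> F.alg_independent J (\<lambda>i. to_fract (f i))}"
  have "{} \<in> ?C" by (simp add: F.alg_independent_empty)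
  then have "\<exists>J\<in>?C. \<forall>J'\<in>?C. J \<subseteq> J' \<longrightarrow> J = J'"
    by (intro finite_has_maximal[OF finite]) blast
  then obtain J where J: "J \<in> ?C" and max: "\<And>J'. J' \<in> ?C \<Longrightarrow> J \<subseteq> J' \<Longrightarrow> J = J'"
    by meson
  then obtain f where f: "f ` J \<subseteq> low_invariants d" "F.alg_independent J (\<lambda>i. to_fract (f i))" by blast
  have "J = UNIV"
  proof (rule ccontr)
    assume "J \<noteq> UNIV"
    then obtain i where i: "i \<notin> J" by blast
    let ?E = "F.generated_field J (\<lambda>i. to_fract (f i))"
    note E = F.subfield_generated_field[of J "\<lambda>i. to_fract (f i)"]
    have "(F.TA.algebraic over ?E) (to_fract s)" if "s \<in> low_invariants d" for s
    proof (rule F.alg_independent_maximal[OF _ i f(2)])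
      show "\<not> F.alg_independent (insert i J) ((\<lambda>i. to_fract (f i))(i := to_fract s))"
      proof
        assume "F.alg_independent (insert i J) ((\<lambda>i. to_fract (f i))(i := to_fract s))"
        also have "(\<lambda>i. to_fract (f i))(i := to_fract s) = (\<lambda>j. to_fract ((f(i := s)) j))" by auto
        finally have "insert i J \<in> ?C"
          using f(1) that i by (auto intro!: exI[of _ "f(i := s)"])
        then show False using max[of "insert i J"] i by blast
      qed
    qed simp
    then have "low_subfield d \<subseteq> {x \<in> carrier ring_of_type_algebra. (F.TA.algebraic over ?E) x}"
      unfolding low_degree_subfield_def
      by (intro F.TA.generate_field_min_subfield1[OF _ F.TA.subfield_of_algebraics[OF E]])
        (auto simp: to_fract_def)
    \<comment> \<open>By maximality the low-degree invariants are algebraic over \<open>?E\<close>.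
      Facts 1 to 5 climb from there through \<open>low_subfield d\<close> and
      \<open>fixed_field\<close> to the coordinates; their independence then forces
      \<open>card J\<close> to be at least \<open>CARD('n)\<close>.\<close>
    then have 1: "(F.TA.algebraic over ?E) x" if "x \<in> low_subfield d" for x using that by blast
    note K = subfieldE(1)[OF subfield_fixed_field] and L = subfieldE(1)[OF subfield_low_subfield[of d]]
    have 2: "(F.TA.algebraic over low_subfield d) x" if "x \<in> fixed_field" for x
      using F.TA.finite_dimension_imp_algebraic[OF subfield_low_subfield K assms that] .
    have 3: "(F.TA.algebraic over ?E) x" if "x \<in> fixed_field" for x
      by (rule F.TA.algebraic_trans[OF E L _ 1 2[OF that]]) auto
    have 4: "(F.TA.algebraic over fixed_field) (to_fract (mvar i))" for i
      by (rule mvar_algebraic) (use to_fract_in_fixed_field in blast)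
    have 5: "(F.TA.algebraic over ?E) (to_fract (mvar i))" for i
      by (rule F.TA.algebraic_trans[OF E K _ 3 4]) auto
    have "F.TA.finite_dimension ?E (UNIV :: ('n, 'k) mpoly fract set)"
      by (rule finite_dimension_if_mvar_algebraic[OF E _ 5])
        (auto simp: F.generated_field_def intro: generate_field.incl)
    moreover have "F.alg_independent UNIV (\<lambda>i :: 'n. to_fract (mvar i))"
      by (simp add: alg_independent_to_fract alg_independent_mvar)
    ultimately have "card (UNIV :: 'n set) \<le> card J"
      by (intro F.finite_dimension_card_le) auto
    with i show False
      using psubset_card_mono[of UNIV J] by auto
  qed
  with f show ?thesis by (auto simp: alg_independent_to_fract)
qed

section \<open>Polynomials with pairwise distinct conjugates\<close>

lemma act_mvar_distinct:
  assumes "g \<in> carrier G" "h \<in> carrier G" "g \<noteq> h"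
  shows "\<exists>i. act g (mvar i) \<noteq> act h (mvar i)"
proof (rule ccontr)
  assume "\<nexists>i. act g (mvar i) \<noteq> act h (mvar i)"
  then have eq: "act g (mvar i) = act h (mvar i)" for i by blast
  interpret E: coefficient_hom "\<lambda>c :: 'k. c" by (rule coefficient_hom_id)
  \<comment> \<open>The conjugates of the coordinates under \<open>k\<close> determine the operator
    \<open>\<rho> (inv k)\<close>, so equal conjugates under \<open>g\<close> and \<open>h\<close>
    contradict faithfulness.\<close>
  have coord: "coordinate scale e i (\<rho> (inv k) v) =
      meval (\<lambda>c. c) (\<lambda>i. coordinate scale e i v) (act k (mvar i))" if "k \<in> carrier G" for k i v
    by (simp only: poly_act_eval[OF representation basis that] E.meval_mvar)
  have "\<rho> (inv g) v = \<rho> (inv h) v" for v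
    by (subst (1 2) coordinate_sum[OF representation basis, symmetric])
      (simp only: coord[OF assms(1)] coord[OF assms(2)] eq)
  then have "\<rho> (inv g) = \<rho> (inv h)" by (rule ext)
  then have "inv g = inv h"
    using faithful_action.faithful[OF faithful_rep] assms
    by (elim inj_onD) (auto intro: rho.G.inv_closed)
  then have "inv (inv g) = inv (inv h)" by (rule arg_cong)
  then show False using assms by simp
qed

text \<open>
  Over a finite field there may be no linear form with pairwise distinct conjugates; instead the
  coefficients of the linear form are powers of an invariant polynomial that avoids finitely many
  values.
\<close>

lemma exists_distinct_conjugates:
  assumes "infinite (poly_invariants G scale \<rho> e)"
  shows "\<exists>\<theta>. inj_on (\<lambda>g. act g \<theta>) (carrier G)"
proof -
  obtain k :: "'n \<Rightarrow> nat" where k: "inj k"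
    using finite_imp_inj_to_nat_seg[of "UNIV :: 'n set"] by auto
  \<comment> \<open>At an invariant \<open>u\<close>, the value of \<open>D g h\<close> is the
    difference of two conjugates of the \<open>\<theta>\<close> below, so \<open>u\<close> has to
    avoid the roots of all \<open>D g h\<close>. The exponents \<open>k i\<close> are distinct,
    hence nothing cancels in \<open>D g h\<close>.\<close>
  define D where "D g h = (\<Sum>i\<in>UNIV. monom (act g (mvar i) - act h (mvar i)) (k i))" for g h
  let ?P = "{(g, h). g \<in> carrier G \<and> h \<in> carrier G \<and> g \<noteq> h}"
  have "D g h \<noteq> 0" if gh: "g \<in> carrier G" "h \<in> carrier G" "g \<noteq> h" for g h
  proof -
    obtain i where i: "act g (mvar i) \<noteq> act h (mvar i)" using act_mvar_distinct[OF gh] by blast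
    have "coeff (D g h) (k i) = (\<Sum>j\<in>UNIV. if j = i then act g (mvar j) - act h (mvar j) else 0)"
      unfolding D_def coeff_sum using k by (intro sum.cong) (auto simp: inj_eq)
    then have "coeff (D g h) (k i) \<noteq> 0" using i by simp
    then show ?thesis by auto
  qed
  moreover have "finite ?P"
    by (rule finite_subset[of _ "carrier G \<times> carrier G"]) (auto simp: finite_group)
  ultimately have "(\<Prod>(g, h)\<in>?P. D g h) \<noteq> 0"
    by (auto simp: prod_zero_iff)
  then have "finite {u. poly (\<Prod>(g, h)\<in>?P. D g h) u = 0}"
    by (rule poly_roots_finite)
  then obtain u where u: "u \<in> poly_invariants G scale \<rho> e" "poly (\<Prod>(g, h)\<in>?P. D g h) u \<noteq> 0"
    using assms by (metis (mono_tags, lifting) finite_subset mem_Collect_eq subsetI)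
  define \<theta> where "\<theta> = (\<Sum>i\<in>UNIV. mvar i * u ^ k i)"
  have \<theta>: "act g \<theta> = (\<Sum>i\<in>UNIV. act g (mvar i) * u ^ k i)" if "g \<in> carrier G" for g
    using u(1) that by (simp add: \<theta>_def act_sum act_times act_power poly_invariants_def)
  have "act g \<theta> \<noteq> act h \<theta>" if gh: "g \<in> carrier G" "h \<in> carrier G" "g \<noteq> h" for g h
  proof -
    have "poly (D g h) u \<noteq> 0"
      using u(2) gh \<open>finite ?P\<close> by (auto simp: poly_prod)
    moreover have "poly (D g h) u = act g \<theta> - act h \<theta>"
      using gh by (simp add: \<theta> D_def poly_sum poly_monom left_diff_distrib sum_subtractf)
    ultimately show ?thesis by simp
  qed
  then show ?thesis by (auto simp: inj_on_def)
qed

text \<open>Applying \<open>g\<close> to the relation changes only \<open>\<theta>\<close>, so its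
  conjugates are |G| distinct roots of a polynomial of degree below |G|.\<close>

lemma invariant_relation_trivial:
  assumes \<theta>: "inj_on (\<lambda>g. act g \<theta>) (carrier G)"
    and a: "\<And>j. a j \<in> poly_invariants G scale \<rho> e"
    and rel: "(\<Sum>j<Coset.order G. a j * \<theta> ^ j) = 0" and j: "j < Coset.order G"
  shows "a j = 0"
proof -
  let ?p = "\<Sum>j<Coset.order G. monom (a j) j"
  have "poly ?p (act g \<theta>) = 0" if "g \<in> carrier G" for g
  proof -
    have "poly ?p (act g \<theta>) = act g (\<Sum>j<Coset.order G. a j * \<theta> ^ j)"
      using a that by (simp add: poly_sum poly_monom act_sum act_times act_power poly_invariants_def)
    then show ?thesis by (simp add: rel coefficient_hom.hom_zero[OF coefficient_hom_act])
  qed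
  then have root: "(\<lambda>g. act g \<theta>) ` carrier G \<subseteq> {x. poly ?p x = 0}" by blast
  have deg: "degree ?p < Coset.order G"
    using order_pos by (intro degree_sum_less) (auto intro: le_less_trans[OF degree_monom_le])
  have "?p = 0"
  proof (rule ccontr)
    assume "?p \<noteq> 0"
    have "Coset.order G = card ((\<lambda>g. act g \<theta>) ` carrier G)"
      by (simp only: card_image[OF \<theta>] Coset.order_def)
    also have "\<dots> \<le> card {x. poly ?p x = 0}"
      by (rule card_mono[OF poly_roots_finite[OF \<open>?p \<noteq> 0\<close>] root])
    also have "\<dots> \<le> degree ?p" by (rule card_poly_roots_bound[OF \<open>?p \<noteq> 0\<close>])
    finally show False using deg by simp
  qed
  then have "coeff ?p j = 0" by simp
  then show ?thesis using j by (simp add: coeff_sum)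
qed

section \<open>The dimension count\<close>

lemma order_le_power:
  assumes f: "range f \<subseteq> low_invariants d" and indep: "M.alg_independent (UNIV :: 'n set) f"
  shows "Coset.order G \<le> d ^ CARD('n)"
proof -
  let ?inv = "poly_invariants G scale \<rho> e"
  have inv_mult: "p * q \<in> ?inv" if "p \<in> ?inv" "q \<in> ?inv" for p q
    using that by (simp add: poly_invariants_def act_times)
  have monom_inv: "M.monomial UNIV f \<alpha> \<in> ?inv" for \<alpha>
    using f by (auto simp: poly_invariants_def poly_invariants_le_def M.monomial_def act_prod act_power
        intro!: prod.cong)
  have fin: "finite ((UNIV :: 'n set) \<rightarrow>\<^sub>E {..t})" for t :: nat by (intro finite_PiE) auto
  \<comment> \<open>The monomials in \<open>f\<close> are distinct invariants, and the box with
    \<open>t = card ?inv\<close> has more than \<open>card ?inv\<close> of them.\<close>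
  have "infinite ?inv"
  proof
    assume "finite ?inv"
    have "(t + 1) ^ CARD('n) \<le> card ?inv" for t
    proof -
      have "inj_on (M.monomial UNIV f) (UNIV \<rightarrow>\<^sub>E {..t})"
        using indep fin by (intro M.independent_family_inj_on) (auto simp: M.alg_independent_def)
      then have "card ((UNIV :: 'n set) \<rightarrow>\<^sub>E {..t}) \<le> card ?inv"
        using monom_inv \<open>finite ?inv\<close> by (intro card_inj_on_le) auto
      then show ?thesis by (simp add: card_PiE)
    qed
    from this[of "card ?inv"] have "(card ?inv + 1) ^ 1 \<le> card ?inv"
      using power_increasing[of 1 "CARD('n)" "card ?inv + 1"] by (simp add: Suc_le_eq)
    then show False by simp
  qed
  then obtain \<theta> where \<theta>: "inj_on (\<lambda>g. act g \<theta>) (carrier G)"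
    using exists_distinct_conjugates by blast
  let ?m = "Coset.order G"
  \<comment> \<open>A bound, independent of \<open>t\<close>, for the degrees of the powers
    \<open>\<theta> ^ j\<close> with \<open>j < ?m\<close>.\<close>
  let ?C = "?m * total_degree \<theta>"
  let ?v = "\<lambda>(j, \<alpha>). \<theta> ^ j * M.monomial UNIV f \<alpha>"
  have "?m * card (simplex t :: ('n \<Rightarrow> nat) set) \<le> card (simplex (d * t + ?C) :: ('n \<Rightarrow> nat) set)" for t
  proof -
    let ?I = "{..<?m} \<times> (simplex t :: ('n \<Rightarrow> nat) set)"
    have "M.independent_family ?v ?I"
      unfolding M.independent_family_def
    proof (intro allI impI, clarify)
      fix c j and \<alpha> :: "'n \<Rightarrow> nat"
      assume 0: "(\<Sum>x\<in>?I. mconst (c x) * (case x of (j, \<alpha>) \<Rightarrow> \<theta> ^ j * M.monomial UNIV f \<alpha>)) = 0"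
        and j: "j < ?m" and \<alpha>: "\<alpha> \<in> simplex t"
      \<comment> \<open>Sorting the relation by powers of \<open>\<theta>\<close> gives invariant
        coefficients. They vanish by the distinct conjugates of \<open>\<theta>\<close>, and then
        the \<open>c (j, \<alpha>)\<close> vanish by the independence of \<open>f\<close>.\<close>
      define a where "a j = (\<Sum>\<alpha>\<in>simplex t. mconst (c (j, \<alpha>)) * M.monomial UNIV f \<alpha>)" for j
      have "a j \<in> ?inv" for j
        using monom_inv by (simp add: a_def poly_invariants_def act_sum act_times act_mconst)
      moreover have "(\<Sum>j<?m. a j * \<theta> ^ j) = 0"
      proof -
        have "a j * \<theta> ^ j = (\<Sum>\<alpha>\<in>simplex t. mconst (c (j, \<alpha>)) * (\<theta> ^ j * M.monomial UNIV f \<alpha>))" for j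
          unfolding a_def sum_distrib_right by (simp only: mult_ac)
        then show ?thesis
          using 0 by (simp add: sum.cartesian_product case_prod_unfold)
      qed
      ultimately have "a j = 0"
        using invariant_relation_trivial[OF \<theta>, of a j] j by blast
      moreover have "M.independent_family (M.monomial UNIV f) (simplex t)"
        using indep by (intro M.independent_family_subset[OF _ fin simplex_subset_box])
          (simp add: M.alg_independent_def)
      ultimately show "c (j, \<alpha>) = 0"
        using M.independent_familyD[of "M.monomial UNIV f" "simplex t" "\<lambda>\<alpha>. c (j, \<alpha>)" \<alpha>] \<alpha>
        unfolding a_def by blast
    qed
    moreover have "total_degree (\<theta> ^ j * M.monomial UNIV f \<alpha>) \<le> d * t + ?C"
      if "j < ?m" "\<alpha> \<in> simplex t" for j \<alpha>
    proof -
      have \<theta>_le: "total_degree (\<theta> ^ j) \<le> ?C"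
        by (rule order_trans[OF total_degree_power[OF order_refl]]) (use that in simp)
      have "total_degree (f i ^ \<alpha> i) \<le> \<alpha> i * d" for i
        using f by (intro total_degree_power) (auto simp: poly_invariants_le_def)
      then have "total_degree (M.monomial UNIV f \<alpha>) \<le> (\<Sum>i\<in>UNIV. \<alpha> i * d)"
        unfolding M.monomial_def by (rule total_degree_prod)
      also have "\<dots> \<le> d * t"
        using that by (simp add: simplex_def mult.commute flip: sum_distrib_left)
      finally have "total_degree (M.monomial UNIV f \<alpha>) \<le> d * t" .
      from total_degree_mult[OF \<theta>_le this] show ?thesis by (simp add: add.commute)
    qed
    then have "?v ` ?I \<subseteq> M.vs.span (M.monomial UNIV mvar ` simplex (d * t + ?C))"
      by (auto intro: span_total_degree)
    ultimately have "card ?I \<le> card (M.monomial UNIV mvar ` (simplex (d * t + ?C) :: ('n \<Rightarrow> nat) set))"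
      by (intro M.independent_family_card_le) auto
    also have "\<dots> \<le> card (simplex (d * t + ?C) :: ('n \<Rightarrow> nat) set)"
      by (rule card_image_le) simp
    finally show ?thesis by (simp add: card_cartesian_product)
  qed
  then show ?thesis
    using order_pos by (rule card_simplex_imp_le_power)
qed

lemma dim_eq_card: "rep.dim UNIV = CARD('n)"
proof -
  have "rep.dim UNIV = card (Set.range e)"
    using basis by (intro rep.dim_unique[of "Set.range e"]) (auto simp: indexed_basis_def)
  then show ?thesis
    using basis by (simp add: indexed_basis_def card_image)
qed

end

theorem theorem3p2:
  fixes G :: "('g, 'm) monoid_scheme"
    and scale :: "'k::field \<Rightarrow> 'v::ab_group_add \<Rightarrow> 'v"
    and \<rho> :: "'g \<Rightarrow> 'v \<Rightarrow> 'v"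
    and e :: "'n::{finite, linorder} \<Rightarrow> 'v"
    and N :: nat
  assumes "finite (carrier G)"
    and "linear_representation G scale \<rho>"
    and "faithful_action G UNIV \<rho>"
    and "indexed_basis scale e"
    and "vector_space.dim scale UNIV = N"
    and "N \<ge> 1"
  shows "real (gamma_field G scale \<rho> e) \<ge> root N (real (Coset.order G))"
proof -
  interpret finite_faithful_representation G scale \<rho> e
    using assms by (intro finite_faithful_representation.intro)
  let ?d = "gamma_field G scale \<rho> e"
  obtain f where "range f \<subseteq> low_invariants ?d" "M.alg_independent (UNIV :: 'n set) f"
    using exists_alg_independent[OF finite_dimension_gamma_field] by blast
  then have "Coset.order G \<le> ?d ^ N"
    using order_le_power dim_eq_card assms(5) by simp
  then have "root N (real (Coset.order G)) \<le> root N (real ?d ^ N)"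
    using assms(6) by (intro real_root_le_mono) (simp_all flip: of_nat_power)
  also have "\<dots> = real ?d"
    using assms(6) by (simp add: real_root_power_cancel)
  finally show ?thesis .
qed

end
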